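(* There exists a single acknowledgment-based Contention Resolution protocol $\mathcal D$ in the GlobalClock model (not depending on $n$) whose high-probability latency, even against an adaptive adversary, satisfies $$L^{\mathrm{whp}}_{\mathcal D}(n)=O\bigl(n\,\zeta(4\log\log n)\bigr)=n(\log\log n)^{1+o(1)}\qquad (n\to\infty),$$ where $$\zeta(x)=(2x)(2\log x)(2\log^{(2)}x)\cdots(2\log^{(\log^* x)}x).$$
   Context: Logarithms are base 2; $\log^{(0)}x=x$, $\log^{(i+1)}x=\log(\log^{(i)}x)$, and $\log^* x$ is the largest $i\ge 0$ with $\log^{(i)}x\ge 1$ (for $x\ge 1$), so the product $\zeta(x)$ runs over all iterated logarithms of $x$ that are at least $1$. Contention Resolution. Time is divided into slots indexed by $\mathbb N$. There are $n$ identical parties; $n$ is unknown to the protocol, so one fixed protocol is used for all $n$. An adversary wakes up the $n$ parties; $t_u$ is the wake-up time of party $u$. An acknowledgment-based protocol in the GlobalClock model is a family $\mathcal D=(\mathcal D_{t^*})_{t^*\in\mathbb N}$ of distributions over infinite binary sequences: each party $u$ independently draws $X^{(u)}=(X^{(u)}_1,X^{(u)}_2,\dots)\sim\mathcal D_{t_u}$, and attempts to grab the shared resource in slot $t_u+i$ ($i\ge1$) iff $X^{(u)}_i=1$ and $u$ has not succeeded in an earlier slot. A party succeeds in a slot iff it is the only party attempting to grab in that slot. Parties receive no feedback other than learning of their own success. An adaptive adversary decides in each slot how many parties to wake up, based on the state and history of all parties; in total it wakes up $n$ parties. The latency of $u$ is $L^{(u)}_{\mathcal D,\mathcal A[n]}=t_u^{\mathrm{succ}}-t_u$,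 where $t_u^{\mathrm{succ}}$ is the slot in which $u$ succeeds ($\infty$ if never). $L_{\mathcal D}(n,q)$ is the least $L\in\mathbb N\cup\{\infty\}$ such that for every adversarial strategy $\mathcal A[n]$ waking up $n$ parties and every party $u$, $\Pr[L^{(u)}_{\mathcal D,\mathcal A[n]}\le L]\ge 1-q$; and $L^{\mathrm{whp}}_{\mathcal D}(n)=L_{\mathcal D}(n,n^{-2})$. *)

theory Defs
  imports "HOL-Probability.Probability" "HOL-Library.Landau_Symbols"
begin

definition iter_log :: "nat \<Rightarrow> real \<Rightarrow> real" where
  "iter_log i x = (log 2 ^^ i) x"

(* The library's log is total: past the first iterate below 1 it produces values without
   meaning, which may again be at least 1.  Requiring all earlier iterates to be at least 1
   excludes these; for x >= 1 this is the largest i for which the i-th iterate is defined in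
   the usual sense and at least 1. *)
definition log_star :: "real \<Rightarrow> nat" where
  "log_star x = (GREATEST i. \<forall>j\<le>i. iter_log j x \<ge> 1)"

definition zeta :: "real \<Rightarrow> real" where
  "zeta x = (\<Prod>i\<le>log_star x. 2 * iter_log i x)"

(* D t is the law of the binary sequence drawn by a party that wakes up in slot t.  Sequences
   are indexed from 0: entry i of the sequence concerns slot t + 1 + i. *)
definition gc_protocol :: "(nat \<Rightarrow> (nat \<Rightarrow> bool) measure) \<Rightarrow> bool" where
  "gc_protocol D \<longleftrightarrow>
     (\<forall>t. prob_space (D t) \<and> sets (D t) = sets (\<Pi>\<^sub>M i\<in>UNIV. count_space (UNIV :: bool set)))"

(* A table of independent sequences, one for every party u and every conceivable wake-up slot t.
   A run reads, for each party u, only the entry \<omega> (u, t) at the actual wake-up slot t of u.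
   Since t is determined before any bit of that entry is used, the sequence of u has law D t
   conditionally on everything that happened up to slot t. *)
definition sample_space ::
    "(nat \<Rightarrow> (nat \<Rightarrow> bool) measure) \<Rightarrow> (nat \<times> nat \<Rightarrow> nat \<Rightarrow> bool) measure" where
  "sample_space D = (\<Pi>\<^sub>M ut\<in>UNIV. D (snd ut))"

(* A strategy maps the record [S 0, ..., S t] to the number of parties woken up in slot t, where
   S s is the set of parties attempting to grab in slot s.  The wake-ups and the successes up to
   now are functions of this record, so they need not be recorded.  The parties are named
   0, 1, 2, ... in the order in which they are woken up. *)
type_synonym strategy = "nat set list \<Rightarrow> nat"

(* number of parties woken up in the slots s < length h *)
definition woken :: "strategy \<Rightarrow> nat set list \<Rightarrow> nat" where
  "woken A h = (\<Sum>s<length h. A (take (Suc s) h))"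

(* H s is the record of the slots r < s; the wake-up slot s of u is determined by H (Suc s) *)
definition wake_slot :: "strategy \<Rightarrow> (nat \<Rightarrow> nat set list) \<Rightarrow> nat \<Rightarrow> nat" where
  "wake_slot A H u = (LEAST s. u < woken A (H (Suc s)))"

(* the parties attempting to grab in slot length h, after the record h; u has succeeded in an
   earlier slot iff {u} occurs in h *)
definition attempting ::
    "strategy \<Rightarrow> (nat \<times> nat \<Rightarrow> nat \<Rightarrow> bool) \<Rightarrow> nat set list \<Rightarrow> nat set" where
  "attempting A \<omega> h =
     {u. u < woken A h \<and> {u} \<notin> set h \<and>
         (let t = wake_slot A (\<lambda>s. take s h) u in \<omega> (u, t) (length h - Suc t))}"

primrec history ::
    "strategy \<Rightarrow> (nat \<times> nat \<Rightarrow> nat \<Rightarrow> bool) \<Rightarrow> nat \<Rightarrow> nat set list" where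
  "history A \<omega> 0 = []"
| "history A \<omega> (Suc t) = history A \<omega> t @ [attempting A \<omega> (history A \<omega> t)]"

definition wake_time :: "strategy \<Rightarrow> (nat \<times> nat \<Rightarrow> nat \<Rightarrow> bool) \<Rightarrow> nat \<Rightarrow> nat" where
  "wake_time A \<omega> u = wake_slot A (history A \<omega>) u"

(* Inf {} = \<infinity>: the party never succeeds *)
definition success_time :: "strategy \<Rightarrow> (nat \<times> nat \<Rightarrow> nat \<Rightarrow> bool) \<Rightarrow> nat \<Rightarrow> enat" where
  "success_time A \<omega> u = Inf {enat s |s. attempting A \<omega> (history A \<omega> s) = {u}}"

definition latency :: "strategy \<Rightarrow> (nat \<times> nat \<Rightarrow> nat \<Rightarrow> bool) \<Rightarrow> nat \<Rightarrow> enat" where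
  "latency A \<omega> u = success_time A \<omega> u - enat (wake_time A \<omega> u)"

definition wakes_up ::
    "(nat \<Rightarrow> (nat \<Rightarrow> bool) measure) \<Rightarrow> nat \<Rightarrow> strategy \<Rightarrow> bool" where
  "wakes_up D n A \<longleftrightarrow>
     (AE \<omega> in sample_space D. eventually (\<lambda>t. woken A (history A \<omega> t) = n) sequentially)"

definition protocol_latency ::
    "(nat \<Rightarrow> (nat \<Rightarrow> bool) measure) \<Rightarrow> nat \<Rightarrow> real \<Rightarrow> enat" where
  "protocol_latency D n q =
     (LEAST L. \<forall>A. wakes_up D n A \<longrightarrow>
        (\<forall>u<n. measure (sample_space D)
                 {\<omega> \<in> space (sample_space D). latency A \<omega> u \<le> L} \<ge> 1 - q))"

definition whp_latency :: "(nat \<Rightarrow> (nat \<Rightarrow> bool) measure) \<Rightarrow> nat \<Rightarrow> enat" where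
  "whp_latency D n = protocol_latency D n (1 / real n ^ 2)"

end

theory Submission
  imports Defs "HOL-Real_Asymp.Real_Asymp"
begin

text \<open>
  The slots are divided among levels \<open>i = 0, 1, 2, \<dots>\<close> by a prefix code on the slot number, so
  that level \<open>i\<close> recurs with period \<open>O(\<zeta>(i))\<close>. In a slot of level \<open>i\<close>, a party of age \<open>a\<close> sends
  with probability \<open>min 1 (2 ^ i * h a)\<close>, where \<open>h a = 1 / (a (1 + log a)\<^sup>2)\<close> is summable. Let
  \<open>C i\<close> be the sum of these probabilities over the parties that are still trying. Summability of
  \<open>h\<close> makes \<open>C 0 > 1/4\<close> a rare event, and \<open>C (i + 1) \<le> 2 * C i\<close>. Hence, at the top level
  \<open>I = 4 log log n\<close>, either \<open>C I \<le> 1/2\<close>, or some level in between has contention of order 1, in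
  which case its next slot produces a success with constant probability. As there are only \<open>n\<close>
  successes and \<open>n\<close> arrivals, the second case occurs in only \<open>O(n)\<close> periods of level \<open>I\<close>. Among
  the \<open>O(n)\<close> periods after its wake-up a party therefore finds \<open>n\<close> slots of level \<open>I\<close> with
  contention at most 1/2, where it sends with probability at least \<open>2 ^ I * h T\<close>, \<open>T = O(n \<zeta>(I))\<close>;
  as \<open>2 ^ I\<close> is about \<open>(log n) ^ 4\<close>, it succeeds with high probability. Adaptivity is handled by
  exponential supermartingales over the finitely many possible histories of each length.
\<close>

section \<open>Growth of the function zeta\<close>

text \<open>The tangent of \<open>ln\<close> at 2 has slope 1/2, which is below \<open>ln 2\<close>.
  This drop by at least one makes recursion along \<open>log 2\<close> terminate.\<close>

lemma log2_le_minus_one: "log 2 x \<le> x - 1" if "2 \<le> x" for x :: real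
proof -
  have "ln (x / 2) \<le> x / 2 - 1" using that by (intro ln_le_minus_one) auto
  moreover have "ln (x / 2) = ln x - ln 2" using that by (simp add: ln_div)
  moreover have "1/2 * (x - 2) \<le> ln 2 * (x - 2)"
    using that ln2_ge_two_thirds by (intro mult_right_mono) auto
  ultimately have "ln x \<le> (x - 1) * ln 2" by (simp only: algebra_simps)
  then show ?thesis by (simp add: log_def divide_simps)
qed

lemma iter_log_0 [simp]: "iter_log 0 x = x"
  by (simp add: iter_log_def)

lemma iter_log_Suc: "iter_log (Suc i) x = iter_log i (log 2 x)"
  by (simp add: iter_log_def funpow_Suc_right del: funpow.simps)

text \<open>The \<open>GREATEST\<close> in \<open>log_star\<close> needs bounded indices: every
  logarithm taken lowers the value by at least one.\<close>

lemma iter_log_index_bound: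
  assumes "\<forall>j\<le>i. iter_log j x \<ge> 1"
  shows "real i \<le> x"
  using assms
proof (induction i arbitrary: x)
  case 0
  then show ?case using iter_log_0[of x] by force
next
  case (Suc i)
  have "x \<ge> 1" using Suc.prems by (force dest: spec[of _ 0])
  moreover have "log 2 x \<ge> 1" using Suc.prems by (force dest: spec[of _ 1] simp: iter_log_Suc)
  ultimately have "x \<ge> 2" by (simp add: le_log_iff)
  moreover have "real i \<le> log 2 x"
    using Suc.prems by (intro Suc.IH) (auto simp: iter_log_Suc dest: spec[of _ "Suc _"])
  ultimately show ?case using log2_le_minus_one[of x] by simp
qed

lemma log_star_eqI:
  assumes "\<forall>j\<le>i. iter_log j x \<ge> 1" "\<not> iter_log (Suc i) x \<ge> 1"
  shows "log_star x = i"
  unfolding log_star_def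
  by (rule Greatest_equality) (use assms not_less_eq_eq in blast)+

lemma iter_log_log_star:
  assumes "x \<ge> 1"
  shows "\<forall>j\<le>log_star x. iter_log j x \<ge> 1" "\<not> iter_log (Suc (log_star x)) x \<ge> 1"
proof -
  let ?P = "\<lambda>i. \<forall>j\<le>i. iter_log j x \<ge> 1"
  have bound: "\<forall>i. ?P i \<longrightarrow> i \<le> nat \<lceil>x\<rceil>"
    using iter_log_index_bound[of _ x] by (meson of_nat_ceiling of_nat_le_iff order_trans)
  have 0: "?P 0" using assms by simp
  show 1: "?P (log_star x)"
    unfolding log_star_def using GreatestI_nat[of ?P, OF 0] bound by blast
  show "\<not> iter_log (Suc (log_star x)) x \<ge> 1"
  proof
    assume "iter_log (Suc (log_star x)) x \<ge> 1"
    with 1 have "?P (Suc (log_star x))" by (auto simp: le_Suc_eq)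
    then have "Suc (log_star x) \<le> log_star x"
      unfolding log_star_def by (rule Greatest_le_nat) (use bound in blast)
    then show False by simp
  qed
qed

lemma zeta_base: "zeta x = 2 * x" if "1 \<le> x" "x < 2"
proof -
  have "log 2 x < 1" using that by (simp add: log_less_iff)
  then have "log_star x = 0"
    using that by (intro log_star_eqI) (auto simp: iter_log_Suc)
  then show ?thesis by (simp add: zeta_def)
qed

text \<open>Together with \<open>zeta_base\<close>, this recursion replaces the product over
  iterated logarithms in all that follows.\<close>

lemma zeta_rec: "zeta x = 2 * x * zeta (log 2 x)" if "2 \<le> x"
proof -
  have 1: "log 2 x \<ge> 1" using that by (simp add: le_log_iff)
  note ls = iter_log_log_star[OF 1]
  have "log_star x = Suc (log_star (log 2 x))"
  proof (intro log_star_eqI allI impI)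
    fix j assume "j \<le> Suc (log_star (log 2 x))"
    then show "iter_log j x \<ge> 1"
      using ls that by (cases j) (auto simp: iter_log_Suc)
  qed (use ls in \<open>simp add: iter_log_Suc\<close>)
  then show ?thesis
    by (simp add: zeta_def prod.atMost_Suc_shift iter_log_Suc del: prod.atMost_Suc)
qed

text \<open>Well-founded because the floor of \<open>x\<close> strictly drops when \<open>x\<close>
  is replaced by \<open>log 2 x\<close>.\<close>

lemma log_induct [consumes 1, case_names base log]:
  assumes "1 \<le> (x::real)"
    and "\<And>x. 1 \<le> x \<Longrightarrow> x < 2 \<Longrightarrow> P x"
    and "\<And>x. 2 \<le> x \<Longrightarrow> P (log 2 x) \<Longrightarrow> P x"
  shows "P x"
  using assms(1)
proof (induction "nat \<lfloor>x\<rfloor>" arbitrary: x rule: less_induct)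
  case less
  show ?case
  proof (cases "x < 2")
    case False
    then have "log 2 x \<le> x - 1" "1 \<le> log 2 x"
      using log2_le_minus_one by (auto simp: le_log_iff)
    moreover from this have "nat \<lfloor>log 2 x\<rfloor> < nat \<lfloor>x\<rfloor>"
      by linarith
    ultimately show ?thesis using less.hyps False assms(3) by auto
  qed (use less.prems assms(2) in auto)
qed

section \<open>Monotonicity and polynomial bounds for \<open>zeta\<close>\<close>

lemma zeta_ge_2: "2 \<le> zeta x" if "1 \<le> x"
  using that
proof (induction x rule: log_induct)
  case (log x)
  then have "2 * 2 * 1 \<le> 2 * x * zeta (log 2 x)" by (intro mult_mono) auto
  then show ?case using log by (simp add: zeta_rec)
qed (simp add: zeta_base)

lemma zeta_mono: "zeta x \<le> zeta y" if "1 \<le> x" "x \<le> y"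
  using that
proof (induction x arbitrary: y rule: log_induct)
  case (base x)
  show ?case
  proof (cases "y < 2")
    case False
    then have "2 * x * 1 \<le> 2 * y * zeta (log 2 y)"
      using base zeta_ge_2[of "log 2 y"] by (intro mult_mono) (auto simp: le_log_iff)
    then show ?thesis using base False by (simp add: zeta_base zeta_rec)
  qed (use base in \<open>simp add: zeta_base\<close>)
next
  case (log x)
  have "zeta (log 2 x) \<le> zeta (log 2 y)" using log by simp
  moreover have "0 \<le> zeta (log 2 x)" using zeta_ge_2[of "log 2 x"] log by (simp add: le_log_iff)
  ultimately have "2 * x * zeta (log 2 x) \<le> 2 * y * zeta (log 2 y)"
    using log by (intro mult_mono) auto
  then show ?case using log by (simp add: zeta_rec)
qed

text \<open>A crude bound that reproduces itself: as \<open>8 powr log 2 x = x ^ 3\<close>, the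
  recursion leaves \<open>2 * x ^ 4\<close>, which is at most \<open>8 powr x\<close> from 2 on. It
  is applied at \<open>log 2 x\<close>, where it is polynomial in \<open>x\<close>.\<close>

lemma zeta_le_exp: "zeta x \<le> 8 powr x" if "1 \<le> x"
  using that
proof (induction x rule: log_induct)
  case (base x)
  have "2 * x \<le> 8 powr 1" using base by simp
  also have "\<dots> \<le> 8 powr x" using base by (intro powr_mono) auto
  finally show ?case using base by (simp add: zeta_base)
next
  case (log x)
  have "8 powr (log 2 x) = (2 powr 3) powr (log 2 x)" by simp
  also have "\<dots> = (2 powr log 2 x) powr 3" by (simp only: powr_powr mult.commute)
  also have "\<dots> = x ^ 3" using log by simp
  finally have "zeta x \<le> 2 * x ^ 4"
    using log by (simp add: zeta_rec power_numeral_reduce mult.assoc)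
  also have "\<dots> \<le> 8 powr x"
  proof -
    have "ln (x / 2) \<le> x / 2 - 1" using log by (intro ln_le_minus_one) auto
    then have "ln x \<le> x / 2 - 1 + ln 2" using log by (simp add: ln_div)
    moreover have "ln 2 \<le> (0.7::real)" "(2/3::real) \<le> ln 2"
      using ln2_ge_two_thirds ln2_le_25_over_36 by auto
    moreover have "2/3 * x \<le> ln 2 * x"
      using log by (intro mult_right_mono ln2_ge_two_thirds) auto
    ultimately have "ln 2 + 4 * ln x \<le> x * (3 * ln 2)"
      by (simp add: algebra_simps)
    moreover have "ln (2 * x ^ 4) = ln 2 + 4 * ln x" using log by (simp add: ln_mult ln_realpow)
    moreover have "ln (8::real) = 3 * ln 2" using ln_realpow[of 2 3] by simp
    then have "ln (8 powr x) = x * (3 * ln 2)" by simp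
    ultimately show ?thesis using log by (subst ln_le_cancel_iff[symmetric]) auto
  qed
  finally show ?case .
qed

lemma zeta_le_power: "zeta x \<le> 2 * x ^ 4" if "2 \<le> x"
proof -
  have "8 powr (log 2 x) = (2 powr 3) powr (log 2 x)" by simp
  also have "\<dots> = (2 powr log 2 x) powr 3" by (simp only: powr_powr mult.commute)
  also have "\<dots> = x ^ 3" using that by simp
  finally have "zeta (log 2 x) \<le> x ^ 3"
    using zeta_le_exp[of "log 2 x"] that by (simp add: le_log_iff)
  then show ?thesis
    using that by (simp add: zeta_rec power_numeral_reduce mult.assoc)
qed

section \<open>Levels of slots\<close>

lemma floor_log_less [termination_simp]: "floor_log x < x" if "0 < x"
  using that less_exp[of "floor_log x"] floor_log_exp2_le[of x] by linarith

(* Elias-style prefix code, read from the low bits of a slot number: a stop bit, or a continuation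
   bit followed by the code of k = floor (log2 x) and the k low bits of x.  The recursion
   len x = 1 + k + len k is what makes 2 ^ len x comparable to zeta x. *)
fun code_len :: "nat \<Rightarrow> nat" where
  [simp del]: "code_len x = (if x = 0 then 1 else 1 + code_len (floor_log x) + floor_log x)"

fun code_word :: "nat \<Rightarrow> nat" where
  [simp del]: "code_word x = (if x = 0 then 0 else
     1 + 2 * (code_word (floor_log x) + 2 ^ code_len (floor_log x) * (x - 2 ^ floor_log x)))"

lemma code_word_less: "code_word x < 2 ^ code_len x"
proof (induction x rule: less_induct)
  case (less x)
  show ?case
  proof (cases "x = 0")
    case False
    let ?k = "floor_log x"
    have "code_word ?k < 2 ^ code_len ?k" using less floor_log_less False by simp
    moreover have "x - 2 ^ ?k + 1 \<le> 2 ^ ?k" using floor_log_exp2_gt[of x] by simp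
    then have "2 ^ code_len ?k * (x - 2 ^ ?k + 1) \<le> 2 ^ code_len ?k * 2 ^ ?k"
      by (intro mult_left_mono) auto
    ultimately have "code_word ?k + 2 ^ code_len ?k * (x - 2 ^ ?k) < 2 ^ (code_len ?k + ?k)"
      by (simp add: power_add algebra_simps)
    then show ?thesis
      using False by (simp add: code_word.simps[of x] code_len.simps[of x])
  qed (simp add: code_word.simps code_len.simps)
qed

text \<open>Decoding: the lowest bit separates 0 from the rest, the induction hypothesis for
  \<open>t div 2\<close> recovers \<open>floor_log x\<close>, and the bits after it are those of
  \<open>x\<close> below its leading one. So no slot carries two levels.\<close>

lemma code_inj:
  assumes "t mod 2 ^ code_len x = code_word x" "t mod 2 ^ code_len y = code_word y"
  shows "x = y"
  using assms
proof (induction x arbitrary: y t rule: less_induct)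
  case (less x)
  have parity: "t mod 2 = (if z = 0 then 0 else 1)" if "t mod 2 ^ code_len z = code_word z" for z
  proof -
    have "t mod 2 = t mod 2 ^ code_len z mod 2"
      by (subst code_len.simps) (simp add: mod_mod_cancel)
    also have "\<dots> = code_word z mod 2" by (simp add: that)
    also have "\<dots> = (if z = 0 then 0 else 1)" by (subst code_word.simps) simp
    finally show ?thesis .
  qed
  have zero: "x = 0 \<longleftrightarrow> y = 0" using parity[OF less.prems(1)] parity[OF less.prems(2)] by (metis zero_neq_one)
  show ?case
  proof (cases "x = 0")
    case False
    have decode: "t div 2 mod 2 ^ code_len (floor_log z) = code_word (floor_log z)"
       "t div 2 div 2 ^ code_len (floor_log z) mod 2 ^ floor_log z = z - 2 ^ floor_log z"
      if "t mod 2 ^ code_len z = code_word z" "z \<noteq> 0" for z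
    proof -
      let ?k = "floor_log z" and ?c = "code_len (floor_log z)"
      let ?v = "code_word ?k + 2 ^ ?c * (z - 2 ^ ?k)"
      have "t mod (2 * 2 ^ (?c + ?k)) = 1 + 2 * ?v"
        using that by (simp add: code_len.simps[of z] code_word.simps[of z])
      moreover have "t mod (2 * 2 ^ (?c + ?k)) = 2 * (t div 2 mod 2 ^ (?c + ?k)) + t mod 2"
        by (rule mod_mult2_eq)
      ultimately have v: "t div 2 mod 2 ^ (?c + ?k) = ?v"
        using parity[OF that(1)] that(2) by simp
      have "t div 2 mod 2 ^ (?c + ?k) mod 2 ^ ?c = t div 2 mod 2 ^ ?c"
        by (simp add: mod_mod_cancel le_imp_power_dvd)
      then show "t div 2 mod 2 ^ ?c = code_word ?k"
        using code_word_less[of ?k] by (simp add: v)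
      moreover have "t div 2 mod 2 ^ (?c + ?k) =
          2 ^ ?c * (t div 2 div 2 ^ ?c mod 2 ^ ?k) + t div 2 mod 2 ^ ?c"
        by (simp add: power_add mod_mult2_eq)
      ultimately show "t div 2 div 2 ^ ?c mod 2 ^ ?k = z - 2 ^ ?k"
        by (simp add: v)
    qed
    note dx = decode[OF less.prems(1) False] and dy = decode[OF less.prems(2)]
    have fl: "floor_log x = floor_log y"
      by (rule less.IH[OF floor_log_less dx(1) dy(1)]) (use False zero in blast)+
    have "x - 2 ^ floor_log x = y - 2 ^ floor_log y"
      using dx(2) dy(2) fl False zero by metis
    moreover have "2 ^ floor_log x \<le> x" "2 ^ floor_log y \<le> y"
      using floor_log_exp2_le False zero by auto
    ultimately show ?thesis using fl by (metis le_add_diff_inverse)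
  qed (use zero in simp)
qed

text \<open>Makes the period of a lower level divide that of a higher one.\<close>

lemma code_len_mono: "code_len x \<le> code_len y" if "x \<le> y"
  using that
proof (induction x arbitrary: y rule: less_induct)
  case (less x)
  show ?case
  proof (cases "x = 0")
    case False
    have "floor_log x \<le> floor_log y" using less.prems by (rule floor_log_le_iff)
    moreover have "code_len (floor_log x) \<le> code_len (floor_log y)"
      using False floor_log_less calculation by (intro less.IH) auto
    ultimately show ?thesis
      using less.prems False by (simp add: code_len.simps[of x] code_len.simps[of y])
  qed (simp add: code_len.simps)
qed

text \<open>With \<open>k = floor_log x\<close>, the identity
  \<open>2 ^ code_len x = 2 * 2 ^ k * 2 ^ code_len k\<close> and \<open>2 ^ k \<le> x\<close> follow
  the recursion of \<open>zeta\<close>. The factor 2 comes from \<open>x = 1\<close>, where equality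
  holds.\<close>

lemma two_power_code_len: "2 ^ code_len x \<le> 2 * zeta (real x)" if "0 < x"
  using that
proof (induction x rule: less_induct)
  case (less x)
  let ?k = "floor_log x"
  show ?case
  proof (cases "x = 1")
    case False
    then have x: "2 \<le> x" using less.prems by simp
    \<comment> \<open>The induction hypothesis covers only positive arguments.\<close>
    have k: "0 < ?k" using floor_log_le_iff[OF x] floor_log_power[of 1] by simp
    have kx: "2 ^ ?k \<le> x" using less.prems by (rule floor_log_exp2_le)
    then have kx': "2 ^ ?k \<le> real x" using of_nat_mono[of "2 ^ ?k" x, where 'a = real] by simp
    have "2 powr real ?k \<le> real x" using kx' by (simp add: powr_realpow)
    then have "real ?k \<le> log 2 (real x)" using x by (subst le_log_iff) auto
    then have "zeta (real ?k) \<le> zeta (log 2 (real x))" using k by (intro zeta_mono) auto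
    moreover have "2 ^ code_len ?k \<le> 2 * zeta (real ?k)"
      using less.IH[of ?k] k less.prems floor_log_less by auto
    ultimately have "2 ^ code_len ?k * 2 ^ ?k \<le> (2 * zeta (log 2 (real x))) * real x"
      using kx' zeta_ge_2[of "log 2 (real x)"] x by (intro mult_mono) (auto simp: le_log_iff)
    then show ?thesis
      using x by (simp add: code_len.simps[of x] zeta_rec power_add algebra_simps)
  qed (simp add: zeta_base code_len.simps)
qed

text \<open>By \<open>code_inj\<close> at most one \<open>x\<close> qualifies, so the choice is
  canonical wherever a code word matches.\<close>

definition level :: "nat \<Rightarrow> nat" where
  "level t = (SOME x. t mod 2 ^ code_len x = code_word x)"

lemma level_eqI: "level t = x" if "t mod 2 ^ code_len x = code_word x"
  unfolding level_def by (rule some1_equality) (use that code_inj in blast)+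

text \<open>A block of length \<open>2 ^ code_len I\<close> starts at a multiple of the period of
  level \<open>i\<close> and is at least as long, so the slot at offset \<open>code_word i\<close>
  lies in it.\<close>

lemma level_in_block:
  assumes "i \<le> I"
  obtains t where "m * 2 ^ code_len I \<le> t" "t < Suc m * 2 ^ code_len I" "level t = i"
proof
  have le: "2 ^ code_len i \<le> (2 ^ code_len I :: nat)"
    using code_len_mono[OF assms] by (intro power_increasing) auto
  have "2 ^ code_len i dvd (2 ^ code_len I :: nat)"
    using code_len_mono[OF assms] by (simp add: le_imp_power_dvd)
  then obtain q where q: "(2 ^ code_len I :: nat) = 2 ^ code_len i * q" ..
  have "(m * 2 ^ code_len I + code_word i) mod 2 ^ code_len i
      = (code_word i + 2 ^ code_len i * (m * q)) mod 2 ^ code_len i"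
    by (simp add: q ac_simps)
  also have "\<dots> = code_word i" using code_word_less[of i] by (subst mod_mult_self2) simp
  finally show "level (m * 2 ^ code_len I + code_word i) = i" by (rule level_eqI)
  show "m * 2 ^ code_len I + code_word i < Suc m * 2 ^ code_len I"
    using order.strict_trans2[OF code_word_less[of i] le] by simp
qed simp

section \<open>Histories of oblivious protocols\<close>

text \<open>Finite cylinders. This serves twice: for the bits of one sequence and for the entries of
  the table of sequences.\<close>

lemma measure_PiM_Collect:
  assumes "\<And>i. i \<in> I \<Longrightarrow> prob_space (M i)" "J \<subseteq> I" "finite J" "\<And>i. i \<in> J \<Longrightarrow> X i \<in> sets (M i)"
  shows "measure (PiM I M) {x \<in> space (PiM I M). \<forall>i\<in>J. x i \<in> X i} = (\<Prod>i\<in>J. measure (M i) (X i))"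
proof -
  have "{x \<in> space (PiM I M). \<forall>i\<in>J. x i \<in> X i} = prod_emb I M J (PiE J X)"
    using assms(2) by (auto simp: prod_emb_def space_PiM PiE_iff extensional_def)
  then have "emeasure (PiM I M) {x \<in> space (PiM I M). \<forall>i\<in>J. x i \<in> X i}
      = (\<Prod>i\<in>J. emeasure (M i) (X i))"
    using emeasure_PiM_emb[OF assms] by simp
  also have "\<dots> = (\<Prod>i\<in>J. ennreal (measure (M i) (X i)))"
  proof (rule prod.cong)
    fix i assume "i \<in> J"
    then interpret prob_space "M i" using assms by auto
    show "emeasure (M i) (X i) = ennreal (measure (M i) (X i))" by (rule emeasure_eq_measure)
  qed simp
  finally show ?thesis by (simp add: measure_def prod_ennreal prod_nonneg)
qed

section \<open>Records and wake-up slots\<close>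

definition alive :: "strategy \<Rightarrow> nat set list \<Rightarrow> nat set" where
  "alive A h = {u. u < woken A h \<and> {u} \<notin> set h}"

text \<open>The wake-up slot read off a finite record, so that it can be used before a run is fixed;
  \<open>wake_time_eq\<close> links it to \<open>wake_time\<close>.\<close>

definition woken_at :: "strategy \<Rightarrow> nat set list \<Rightarrow> nat \<Rightarrow> nat" where
  "woken_at A h u = wake_slot A (\<lambda>s. take s h) u"

lemma finite_alive [simp]: "finite (alive A h)"
  by (rule finite_subset[of _ "{..<woken A h}"]) (auto simp: alive_def)

lemma alive_less_woken: "u \<in> alive A h \<Longrightarrow> u < woken A h"
  by (simp add: alive_def)

lemma attempting_eq:
  "attempting A \<omega> h = {u \<in> alive A h. \<omega> (u, woken_at A h u) (length h - Suc (woken_at A h u))}"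
  by (auto simp: attempting_def alive_def woken_at_def Let_def)

lemma woken_take: "m \<le> length h \<Longrightarrow> woken A (take m h) = (\<Sum>s<m. A (take (Suc s) h))"
  unfolding woken_def by (intro sum.cong) (auto simp: min_def)

lemma woken_take_mono: "i \<le> j \<Longrightarrow> woken A (take i h) \<le> woken A (take j h)"
proof -
  have *: "woken A (take i h) \<le> woken A (take j h)" if "i \<le> j" "j \<le> length h" for i j
    using that by (simp add: woken_take sum_mono2)
  \<comment> \<open>\<open>take\<close> beyond the length is the identity, which reduces arbitrary
    indices to those within the record.\<close>
  have min: "take k h = take (min k (length h)) h" for k by (simp add: min_def)
  assume "i \<le> j"
  then show ?thesis using *[of "min i (length h)" "min j (length h)"] min[of i] min[of j] by simp
qed

lemma woken_take_le: "woken A (take i h) \<le> woken A h"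
  using woken_take_mono[of i "length h + i" A h] by simp

lemma woken_at_props:
  assumes "u < woken A h"
  shows "woken_at A h u < length h" "u < woken A (take (Suc (woken_at A h u)) h)"
    "\<not> u < woken A (take (woken_at A h u) h)"
proof -
  let ?P = "\<lambda>s. u < woken A (take (Suc s) h)"
  have "length h > 0" using assms by (auto simp: woken_def)
  then have last: "?P (length h - 1)" using assms by simp
  show "?P (woken_at A h u)"
    unfolding woken_at_def wake_slot_def by (rule LeastI[of ?P, OF last])
  have "woken_at A h u \<le> length h - 1"
    unfolding woken_at_def wake_slot_def by (rule Least_le[of ?P, OF last])
  then show "woken_at A h u < length h" using \<open>length h > 0\<close> by linarith
  show "\<not> u < woken A (take (woken_at A h u) h)"
  proof (cases "woken_at A h u")
    case (Suc s)
    then have "\<not> ?P s" using not_less_Least[of s ?P] by (simp add: woken_at_def wake_slot_def)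
    then show ?thesis by (simp add: Suc)
  qed (simp add: woken_def)
qed

lemma woken_at_eqI:
  assumes "u < woken A (take (Suc s) h)" "\<not> u < woken A (take s h)"
  shows "woken_at A h u = s"
  unfolding woken_at_def wake_slot_def
proof (rule Least_equality)
  fix r assume "u < woken A (take (Suc r) h)"
  then show "s \<le> r" using assms(2) woken_take_mono[of "Suc r" s A h] by (meson not_less_eq_eq order.strict_trans2)
qed fact

text \<open>The prefix in which a party is woken fixes its wake-up slot, so one value per party
  serves for all longer prefixes.\<close>

lemma woken_at_take:
  assumes "u < woken A (take m h)"
  shows "woken_at A h u = woken_at A (take m h) u"
proof -
  let ?w = "woken_at A (take m h) u"
  note props = woken_at_props[OF assms]
  have "?w < m" using props(1) by simp
  then show ?thesis using props(2,3) by (intro woken_at_eqI) (auto simp: min_def)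
qed

lemma woken_at_append:
  assumes "u < woken A h"
  shows "woken_at A (h @ g) u = woken_at A h u"
  using woken_at_take[of u A "length h" "h @ g"] assms by simp

lemma length_history [simp]: "length (history A \<omega> t) = t"
  by (induction t) auto

lemma take_history: "s \<le> t \<Longrightarrow> take s (history A \<omega> t) = history A \<omega> s"
  by (induction t) (auto simp: le_Suc_eq)

lemma nth_history: "s < t \<Longrightarrow> history A \<omega> t ! s = attempting A \<omega> (history A \<omega> s)"
  by (induction t) (auto simp: nth_append less_Suc_eq)

text \<open>The right-hand side evaluates attempts only after prefixes of the fixed
  \<open>h\<close>, so the wake-up slots in it no longer depend on \<open>\<omega>\<close>.\<close>

lemma history_eq_iff:
  "history A \<omega> t = h \<longleftrightarrow> length h = t \<and> (\<forall>s<t. attempting A \<omega> (take s h) = h ! s)"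
proof (intro iffI conjI)
  assume *: "length h = t \<and> (\<forall>s<t. attempting A \<omega> (take s h) = h ! s)"
  have "s \<le> t \<Longrightarrow> history A \<omega> s = take s h" for s
    by (induction s) (use * in \<open>auto simp: take_Suc_conv_app_nth\<close>)
  from this[of t] show "history A \<omega> t = h" using * by simp
qed (auto simp: take_history nth_history)

lemma wake_time_eq: "wake_time A \<omega> u = woken_at A (history A \<omega> t) u"
  if "u < woken A (history A \<omega> t)"
proof -
  let ?h = "history A \<omega> t" and ?w = "woken_at A (history A \<omega> t) u"
  note props = woken_at_props[OF that]
  have w: "?w < t" using props(1) by simp
  show ?thesis unfolding wake_time_def wake_slot_def
  proof (rule Least_equality)
    show "u < woken A (history A \<omega> (Suc ?w))" using props(2) w by (simp add: take_history)
    fix r assume r: "u < woken A (history A \<omega> (Suc r))"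
    show "?w \<le> r"
    proof (rule ccontr)
      assume "\<not> ?w \<le> r"
      then have "u < woken A (take (Suc r) ?h)" using r w by (simp add: take_history)
      then show False using props(3) woken_take_mono[of "Suc r" ?w A ?h] \<open>\<not> ?w \<le> r\<close> by simp
    qed
  qed
qed

text \<open>A finite set containing every record that can occur, which turns expectations over runs
  into finite sums.\<close>

definition histories :: "strategy \<Rightarrow> nat \<Rightarrow> nat set list set" where
  "histories A t = {h. length h = t \<and> (\<forall>s<t. h ! s \<subseteq> alive A (take s h))}"

lemma history_in_histories: "history A \<omega> t \<in> histories A t"
  by (auto simp: histories_def nth_history take_history attempting_eq)

lemma histories_0 [simp]: "histories A 0 = {[]}"
  by (auto simp: histories_def)

lemma histories_Suc:
  "histories A (Suc t) = (\<lambda>(h, S). h @ [S]) ` (SIGMA h:histories A t. Pow (alive A h))"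
proof (intro equalityI subsetI)
  fix g assume g: "g \<in> histories A (Suc t)"
  then have "g = take t g @ [g ! t]"
    by (simp add: histories_def take_Suc_conv_app_nth[symmetric])
  moreover have "take t g \<in> histories A t" "g ! t \<in> Pow (alive A (take t g))"
    using g by (auto simp: histories_def min_def)
  ultimately show "g \<in> (\<lambda>(h, S). h @ [S]) ` (SIGMA h:histories A t. Pow (alive A h))"
    by (intro image_eqI[of _ _ "(take t g, g ! t)"]) auto
qed (auto simp: histories_def nth_append less_Suc_eq subset_iff)

lemma finite_histories [simp]: "finite (histories A t)"
  by (induction t) (auto simp: histories_Suc)

lemma sum_histories_Suc:
  "(\<Sum>h\<in>histories A (Suc t). f h) = (\<Sum>h\<in>histories A t. \<Sum>S\<in>Pow (alive A h). f (h @ [S]))"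
proof -
  have "inj_on (\<lambda>(h, S). h @ [S]) (SIGMA h:histories A t. Pow (alive A h))"
    by (auto simp: inj_on_def)
  then show ?thesis
    by (simp add: histories_Suc sum.reindex sum.Sigma case_prod_unfold)
qed

section \<open>The law of the record when all bits are independent\<close>

locale oblivious_protocol =
  fixes p :: "nat \<Rightarrow> nat \<Rightarrow> real"
  assumes p_nonneg: "0 \<le> p s a" and p_le_1: "p s a \<le> 1"
begin

text \<open>\<open>p s a\<close> is the probability that a party of age \<open>a\<close> sends in
  slot \<open>s\<close>. Entry \<open>j\<close> of the sequence belongs to slot
  \<open>t + 1 + j\<close>, where the age is \<open>Suc j\<close>.\<close>

definition bit_law :: "nat \<Rightarrow> (nat \<Rightarrow> bool) measure" where
  "bit_law t = (\<Pi>\<^sub>M j\<in>UNIV. measure_pmf (bernoulli_pmf (p (t + 1 + j) (Suc j))))"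

abbreviation \<Omega> :: "(nat \<times> nat \<Rightarrow> nat \<Rightarrow> bool) measure" where
  "\<Omega> \<equiv> sample_space bit_law"

lemma prob_space_bit_law: "prob_space (bit_law t)"
  unfolding bit_law_def by (intro prob_space_PiM measure_pmf.prob_space_axioms)

lemma gc_protocol_bit_law: "gc_protocol bit_law"
  using prob_space_bit_law unfolding gc_protocol_def bit_law_def
  by (auto intro!: sets_PiM_cong)

lemma space_bit_law [simp]: "space (bit_law t) = UNIV"
  by (simp add: bit_law_def space_PiM)

lemma space_sample [simp]: "space \<Omega> = UNIV"
  by (simp add: sample_space_def space_PiM)

lemma prob_space_sample: "prob_space \<Omega>"
  unfolding sample_space_def by (intro prob_space_PiM prob_space_bit_law)

context
  fixes A :: strategy
begin

definition prob_send :: "nat set list \<Rightarrow> nat \<Rightarrow> real" where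
  "prob_send h u = p (length h) (length h - woken_at A h u)"

text \<open>The conditional law of the next attempt set given the record \<open>h\<close>.
  Multiplied along a record it gives \<open>prob_history\<close>, which is later identified with the
  actual probability.\<close>

definition prob_attempt :: "nat set list \<Rightarrow> nat set \<Rightarrow> real" where
  "prob_attempt h S = (\<Prod>u\<in>alive A h. if u \<in> S then prob_send h u else 1 - prob_send h u)"

definition prob_history :: "nat set list \<Rightarrow> real" where
  "prob_history h = (\<Prod>s<length h. prob_attempt (take s h) (h ! s))"

lemma prob_send_bounds: "0 \<le> prob_send h u" "prob_send h u \<le> 1"
  by (auto simp: prob_send_def p_nonneg p_le_1)

lemma prob_attempt_nonneg: "0 \<le> prob_attempt h S"
  unfolding prob_attempt_def by (intro prod_nonneg) (auto simp: prob_send_bounds)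

lemma prob_history_nonneg: "0 \<le> prob_history h"
  unfolding prob_history_def by (intro prod_nonneg) (auto simp: prob_attempt_nonneg)

lemma prob_history_append: "prob_history (h @ [S]) = prob_history h * prob_attempt h S"
  by (simp add: prob_history_def nth_append)

text \<open>Expand the product of the factors \<open>prob_send h u + (1 - prob_send h u)\<close>
  over all subsets.\<close>

lemma sum_prob_attempt: "(\<Sum>S\<in>Pow (alive A h). prob_attempt h S) = 1"
proof -
  have "1 = (\<Prod>u\<in>alive A h. prob_send h u + (1 - prob_send h u))" by simp
  also have "\<dots> = (\<Sum>S\<in>Pow (alive A h). (\<Prod>u\<in>S. prob_send h u) * (\<Prod>u\<in>alive A h - S. 1 - prob_send h u))"
    by (rule prod_add) simp
  also have "\<dots> = (\<Sum>S\<in>Pow (alive A h). prob_attempt h S)"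
  proof (rule sum.cong)
    fix S assume S: "S \<in> Pow (alive A h)"
    have "prob_attempt h S = (\<Prod>u\<in>alive A h - S. if u \<in> S then prob_send h u else 1 - prob_send h u) *
        (\<Prod>u\<in>S. if u \<in> S then prob_send h u else 1 - prob_send h u)"
      unfolding prob_attempt_def using S by (intro prod.subset_diff) auto
    also have "\<dots> = (\<Prod>u\<in>alive A h - S. 1 - prob_send h u) * (\<Prod>u\<in>S. prob_send h u)"
      by (intro arg_cong2[of _ _ _ _ "(*)"] prod.cong) auto
    finally show "(\<Prod>u\<in>S. prob_send h u) * (\<Prod>u\<in>alive A h - S. 1 - prob_send h u) = prob_attempt h S"
      by simp
  qed simp
  finally show ?thesis ..
qed

lemma measure_bits:
  fixes b :: "nat \<Rightarrow> bool"
  assumes "finite R" "\<And>s. s \<in> R \<Longrightarrow> w < s"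
  defines "E \<equiv> {x. \<forall>s\<in>R. x (s - Suc w) = b s}"
  shows "E \<in> sets (bit_law w)"
    and "measure (bit_law w) E = (\<Prod>s\<in>R. if b s then p s (s - w) else 1 - p s (s - w))"
proof -
  let ?M = "\<lambda>j. measure_pmf (bernoulli_pmf (p (w + 1 + j) (Suc j)))"
  let ?J = "(\<lambda>s. s - Suc w) ` R"
  \<comment> \<open>The subtraction is truncated; it is injective because all slots in
    \<open>R\<close> come after \<open>w\<close>.\<close>
  have inj: "inj_on (\<lambda>s. s - Suc w) R"
    using assms(2) by (intro inj_onI) (metis Suc_leI eq_diff_iff)
  have eq: "Suc (s - Suc w + w) = s" if "s \<in> R" for s
    using assms(2)[OF that] by simp
  have E: "E = {x \<in> space (PiM UNIV ?M). \<forall>j\<in>?J. x j \<in> {b (j + Suc w)}}"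
    by (simp add: E_def space_PiM eq)
  show "E \<in> sets (bit_law w)"
    unfolding E bit_law_def using assms(1) by (intro sets.sets_Collect_finite_All) auto
  have "measure (bit_law w) E = (\<Prod>j\<in>?J. measure (?M j) {b (j + Suc w)})"
    unfolding E bit_law_def
    using assms(1) by (intro measure_PiM_Collect measure_pmf.prob_space_axioms) auto
  also have "\<dots> = (\<Prod>s\<in>R. measure (?M (s - Suc w)) {b (s - Suc w + Suc w)})"
    using inj by (simp add: prod.reindex)
  also have "\<dots> = (\<Prod>s\<in>R. if b s then p s (s - w) else 1 - p s (s - w))"
  proof (rule prod.cong)
    fix s assume "s \<in> R"
    then have "w + 1 + (s - Suc w) = s" "Suc (s - Suc w) = s - w" "s - Suc w + Suc w = s"
      using assms(2)[of s] by auto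
    then show "measure (?M (s - Suc w)) {b (s - Suc w + Suc w)} = (if b s then p s (s - w) else 1 - p s (s - w))"
      by (cases "b s") (simp_all add: measure_pmf_single p_nonneg p_le_1)
  qed simp
  finally show "measure (bit_law w) E = (\<Prod>s\<in>R. if b s then p s (s - w) else 1 - p s (s - w))" .
qed

text \<open>This is where adaptivity disappears. On the event that the record is \<open>h\<close>,
  all wake-up slots are constants determined by \<open>h\<close>, so the event is a cylinder over
  the finitely many table entries \<open>(u, woken_at A h u)\<close>, whose bits are
  independent.\<close>

lemma prob_history:
  assumes h: "h \<in> histories A t"
  shows "{\<omega>. history A \<omega> t = h} \<in> sets \<Omega>"
    and "measure \<Omega> {\<omega>. history A \<omega> t = h} = prob_history h"
proof -
  have len: "length h = t" and sub: "\<And>s. s < t \<Longrightarrow> h ! s \<subseteq> alive A (take s h)"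
    using h by (auto simp: histories_def)
  let ?w = "woken_at A h"
  let ?R = "\<lambda>u. {s \<in> {..<t}. u \<in> alive A (take s h)}"
  let ?E = "\<lambda>u. {x. \<forall>s\<in>?R u. x (s - Suc (?w u)) = (u \<in> h ! s)}"
  let ?J = "(\<lambda>u. (u, ?w u)) ` {..<woken A h}"
  have less: "u < woken A h" and w_take: "woken_at A (take s h) u = ?w u" and w_less: "?w u < s"
    if "s < t" "u \<in> alive A (take s h)" for s u
  proof -
    have u: "u < woken A (take s h)" using that(2) by (simp add: alive_def)
    then show "u < woken A h" using woken_take_le[of A s h] by simp
    show "woken_at A (take s h) u = ?w u" using woken_at_take[OF u] by simp
    then show "?w u < s" using woken_at_props(1)[OF u] that(1) len by simp
  qed
  have event: "{\<omega>. history A \<omega> t = h} = {\<omega> \<in> space \<Omega>. \<forall>i\<in>?J. \<omega> i \<in> ?E (fst i)}" (is "?L = ?R'")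
  proof (intro set_eqI)
    fix \<omega>
    have "\<omega> \<in> ?L \<longleftrightarrow> (\<forall>s<t. attempting A \<omega> (take s h) = h ! s)"
      using len by (simp add: history_eq_iff)
    also have "\<dots> \<longleftrightarrow> (\<forall>s<t. \<forall>u\<in>alive A (take s h). \<omega> (u, ?w u) (s - Suc (?w u)) = (u \<in> h ! s))"
    proof (intro all_cong1 imp_cong refl)
      fix s assume s: "s < t"
      have "attempting A \<omega> (take s h) = {u \<in> alive A (take s h). \<omega> (u, ?w u) (s - Suc (?w u))}"
        using s len by (auto simp: attempting_eq w_take)
      then show "attempting A \<omega> (take s h) = h ! s \<longleftrightarrow>
          (\<forall>u\<in>alive A (take s h). \<omega> (u, ?w u) (s - Suc (?w u)) = (u \<in> h ! s))"
        using sub[OF s] by blast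
    qed
    also have "\<dots> \<longleftrightarrow> \<omega> \<in> ?R'"
      using less by fastforce
    finally show "\<omega> \<in> ?L \<longleftrightarrow> \<omega> \<in> ?R'" .
  qed
  have sets_E: "?E u \<in> sets (bit_law (?w u))" for u
    by (rule measure_bits(1)) (auto intro: w_less)
  show "?L \<in> sets \<Omega>"
    unfolding event sample_space_def
  proof (rule sets.sets_Collect_finite_All)
    fix i assume "i \<in> ?J"
    then have "?E (fst i) \<in> sets (bit_law (snd i))" using sets_E by auto
    then show "{\<omega> \<in> space (PiM UNIV (\<lambda>ut. bit_law (snd ut))). \<omega> i \<in> ?E (fst i)}
        \<in> sets (PiM UNIV (\<lambda>ut. bit_law (snd ut)))"
      by (intro sets_Collect_single) auto
  qed simp
  have "measure \<Omega> ?L = (\<Prod>i\<in>?J. measure (bit_law (snd i)) (?E (fst i)))"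
    unfolding event sample_space_def
    using sets_E by (intro measure_PiM_Collect prob_space_bit_law) auto
  also have "\<dots> = (\<Prod>u<woken A h. measure (bit_law (?w u)) (?E u))"
    by (subst prod.reindex) (auto simp: inj_on_def)
  also have "\<dots> = (\<Prod>u<woken A h. \<Prod>s\<in>?R u. if u \<in> h ! s then p s (s - ?w u) else 1 - p s (s - ?w u))"
    by (intro prod.cong refl measure_bits(2)) (auto intro: w_less)
  \<comment> \<open>Regroup from parties to slots, which yields the chain rule along the
    record.\<close>
  also have "\<dots> = (\<Prod>s<t. \<Prod>u\<in>{u. u \<in> {..<woken A h} \<and> u \<in> alive A (take s h)}.
      if u \<in> h ! s then p s (s - ?w u) else 1 - p s (s - ?w u))"
    using prod.swap_restrict[of "{..<woken A h}" "{..<t}"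
       "\<lambda>u s. if u \<in> h ! s then p s (s - ?w u) else 1 - p s (s - ?w u)" "\<lambda>u s. u \<in> alive A (take s h)"]
    by simp
  also have "\<dots> = (\<Prod>s<t. prob_attempt (take s h) (h ! s))"
  proof (intro prod.cong refl)
    fix s assume s: "s \<in> {..<t}"
    have "{u. u \<in> {..<woken A h} \<and> u \<in> alive A (take s h)} = alive A (take s h)"
      using s less by auto
    then show "(\<Prod>u\<in>{u. u \<in> {..<woken A h} \<and> u \<in> alive A (take s h)}.
        if u \<in> h ! s then p s (s - ?w u) else 1 - p s (s - ?w u)) = prob_attempt (take s h) (h ! s)"
      unfolding prob_attempt_def prob_send_def
      using s len by (intro prod.cong) (auto simp: w_take min_def)
  qed
  finally show "measure \<Omega> ?L = prob_history h"
    by (simp add: prob_history_def len)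
qed

section \<open>Expectations over records and supermartingales\<close>

lemma sets_history: "{\<omega>. R (history A \<omega> t)} \<in> sets \<Omega>"
proof -
  have "{\<omega>. R (history A \<omega> t)} = (\<Union>h\<in>{h \<in> histories A t. R h}. {\<omega>. history A \<omega> t = h})"
    using history_in_histories by auto
  also have "\<dots> \<in> sets \<Omega>" using prob_history(1) by (intro sets.finite_UN) auto
  finally show ?thesis .
qed

lemma measure_history:
  "measure \<Omega> {\<omega>. R (history A \<omega> t)} = (\<Sum>h | h \<in> histories A t \<and> R h. prob_history h)"
proof -
  interpret prob_space \<Omega> by (rule prob_space_sample)
  have "{\<omega>. R (history A \<omega> t)} = (\<Union>h\<in>{h \<in> histories A t. R h}. {\<omega>. history A \<omega> t = h})"
    using history_in_histories by auto
  also have "measure \<Omega> \<dots> = (\<Sum>h | h \<in> histories A t \<and> R h. measure \<Omega> {\<omega>. history A \<omega> t = h})"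
    using prob_history(1) by (intro finite_measure_finite_Union) (auto simp: disjoint_family_on_def)
  also have "\<dots> = (\<Sum>h | h \<in> histories A t \<and> R h. prob_history h)"
    using prob_history(2) by (intro sum.cong) auto
  finally show ?thesis .
qed

text \<open>\<open>sum_histories_Suc\<close> exposes the conditional expectation of one step.
  Records of probability zero carry no weight, so the drift condition concerns only the
  others.\<close>

lemma supermartingale:
  assumes "\<And>h. h \<in> histories A (length h) \<Longrightarrow> prob_history h > 0 \<Longrightarrow>
     (\<Sum>S\<in>Pow (alive A h). prob_attempt h S * \<Phi> (h @ [S])) \<le> \<Phi> h"
  shows "(\<Sum>h\<in>histories A t. prob_history h * \<Phi> h) \<le> \<Phi> []"
proof (induction t)
  case (Suc t)
  have "(\<Sum>h\<in>histories A (Suc t). prob_history h * \<Phi> h) =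
      (\<Sum>h\<in>histories A t. prob_history h * (\<Sum>S\<in>Pow (alive A h). prob_attempt h S * \<Phi> (h @ [S])))"
    by (simp add: sum_histories_Suc prob_history_append sum_distrib_left mult.assoc)
  also have "\<dots> \<le> (\<Sum>h\<in>histories A t. prob_history h * \<Phi> h)"
  proof (rule sum_mono)
    fix h assume "h \<in> histories A t"
    moreover from this have "length h = t" by (simp add: histories_def)
    ultimately show "prob_history h * (\<Sum>S\<in>Pow (alive A h). prob_attempt h S * \<Phi> (h @ [S])) \<le> prob_history h * \<Phi> h"
      using assms[of h] prob_history_nonneg[of h]
      by (cases "prob_history h = 0") (auto intro!: mult_left_mono)
  qed
  finally show ?case using Suc by simp
qed (simp add: prob_history_def)

lemma supermartingale_Markov:
  assumes "\<And>h. h \<in> histories A (length h) \<Longrightarrow> prob_history h > 0 \<Longrightarrow>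
     (\<Sum>S\<in>Pow (alive A h). prob_attempt h S * \<Phi> (h @ [S])) \<le> \<Phi> h"
    and "\<And>h. 0 \<le> \<Phi> h" and "0 < c"
    and R: "\<And>h. h \<in> histories A t \<Longrightarrow> prob_history h > 0 \<Longrightarrow> R h \<Longrightarrow> c \<le> \<Phi> h"
  shows "measure \<Omega> {\<omega>. R (history A \<omega> t)} \<le> \<Phi> [] / c"
proof -
  have "measure \<Omega> {\<omega>. R (history A \<omega> t)} * c = (\<Sum>h | h \<in> histories A t \<and> R h. prob_history h * c)"
    by (simp add: measure_history sum_distrib_right)
  also have "\<dots> \<le> (\<Sum>h | h \<in> histories A t \<and> R h. prob_history h * \<Phi> h)"
  proof (rule sum_mono)
    fix h assume "h \<in> {h. h \<in> histories A t \<and> R h}"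
    then show "prob_history h * c \<le> prob_history h * \<Phi> h"
      using R[of h] prob_history_nonneg[of h] by (cases "prob_history h = 0") (auto intro!: mult_left_mono)
  qed
  also have "\<dots> \<le> (\<Sum>h\<in>histories A t. prob_history h * \<Phi> h)"
    by (intro sum_mono2) (auto simp: prob_history_nonneg assms(2))
  also have "\<dots> \<le> \<Phi> []" by (rule supermartingale) (rule assms(1))
  finally show ?thesis using \<open>0 < c\<close> by (simp add: field_simps)
qed

end

end

section \<open>Exponential supermartingales\<close>

text \<open>\<open>R\<close> is tested on the record before each slot, so whether a slot counts is
  known before it is played.\<close>

definition visits :: "(nat set list \<Rightarrow> bool) \<Rightarrow> nat set list \<Rightarrow> nat" where
  "visits R h = card {s. s < length h \<and> R (take s h)}"

definition successes :: "nat set list \<Rightarrow> nat" where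
  "successes h = card {s. s < length h \<and> is_singleton (h ! s)}"

text \<open>A success after the deadline leaves \<open>missed\<close> true. Hence it is frozen once
  the deadline has passed, and the failure events increase in time.\<close>

definition missed :: "strategy \<Rightarrow> nat \<Rightarrow> nat \<Rightarrow> nat set list \<Rightarrow> bool" where
  "missed A u T h \<longleftrightarrow> (\<forall>s<length h. h ! s = {u} \<longrightarrow> woken_at A (take s h) u + T < s)"

lemma visits_Nil [simp]: "visits R [] = 0"
  by (simp add: visits_def)

lemma successes_Nil [simp]: "successes [] = 0"
  by (simp add: successes_def)

lemma missed_Nil [simp]: "missed A u T []"
  by (simp add: missed_def)

lemma visits_append: "visits R (h @ [S]) = visits R h + (if R h then 1 else 0)"
proof -
  have "{s. s < length (h @ [S]) \<and> R (take s (h @ [S]))} =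
      {s. s < length h \<and> R (take s h)} \<union> (if R h then {length h} else {})"
    by (auto simp: less_Suc_eq)
  then show ?thesis by (simp add: visits_def)
qed

lemma successes_append: "successes (h @ [S]) = successes h + (if is_singleton S then 1 else 0)"
proof -
  have "{s. s < length (h @ [S]) \<and> is_singleton ((h @ [S]) ! s)} =
      {s. s < length h \<and> is_singleton (h ! s)} \<union> (if is_singleton S then {length h} else {})"
    by (auto simp: less_Suc_eq nth_append)
  then show ?thesis by (simp add: successes_def)
qed

lemma missed_append:
  "missed A u T (h @ [S]) \<longleftrightarrow> missed A u T h \<and> (S = {u} \<longrightarrow> woken_at A h u + T < length h)"
  by (auto simp: missed_def less_Suc_eq nth_append)

text \<open>A party that was alone once is no longer alive, so the successful slots inject into the
  woken parties.\<close>

lemma successes_le_woken: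
  assumes h: "h \<in> histories A (length h)"
  shows "successes h \<le> woken A h"
proof -
  have alive: "the_elem (h ! s) \<in> alive A (take s h) \<and> h ! s = {the_elem (h ! s)}"
    if "s < length h" "is_singleton (h ! s)" for s
    using that h by (auto simp: histories_def is_singleton_the_elem)
  have "card {s. s < length h \<and> is_singleton (h ! s)} \<le> card {..<woken A h}"
  proof (rule card_inj_on_le[where f = "\<lambda>s. the_elem (h ! s)"])
    show "(\<lambda>s. the_elem (h ! s)) ` {s. s < length h \<and> is_singleton (h ! s)} \<subseteq> {..<woken A h}"
      using alive alive_less_woken woken_take_le[of A _ h] by (fastforce intro: order.strict_trans2)
    have "False" if s: "s < s'" "s' < length h" "is_singleton (h ! s)" "is_singleton (h ! s')"
        "the_elem (h ! s) = the_elem (h ! s')" for s s'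
    proof -
      have "h ! s \<in> set (take s' h)"
        using s by (auto simp: in_set_conv_nth intro!: exI[of _ s])
      then show False using alive[of s] alive[of s'] s by (auto simp: alive_def)
    qed
    then show "inj_on (\<lambda>s. the_elem (h ! s)) {s. s < length h \<and> is_singleton (h ! s)}"
      by (intro inj_onI) (metis (mono_tags) linorder_neqE_nat mem_Collect_eq)
  qed simp
  then show ?thesis by (simp add: successes_def)
qed

context oblivious_protocol
begin

context
  fixes A :: strategy
begin

definition contention :: "nat set list \<Rightarrow> real" where
  "contention h = (\<Sum>u\<in>alive A h. prob_send A h u)"

text \<open>The lower end is 1/4, the guaranteed contention at a level crossing, divided by the
  factor 8 that ageing within a block may cost. The upper end keeps a lone sender undisturbed with
  probability at least 1/2.\<close>

definition critical :: "nat set list \<Rightarrow> bool" where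
  "critical h \<longleftrightarrow> 1 / 32 \<le> contention h \<and> contention h \<le> 1 / 2"

text \<open>By the Weierstrass product inequality, the others stay silent with probability at least
  one minus their total sending probability.\<close>

lemma prob_attempt_singleton:
  assumes "u \<in> alive A h"
  shows "prob_send A h u * (1 - contention h) \<le> prob_attempt A h {u}"
proof -
  have "prob_attempt A h {u} = prob_send A h u * (\<Prod>v\<in>alive A h - {u}. 1 - prob_send A h v)"
    unfolding prob_attempt_def using assms by (subst prod.remove[of _ u]) (auto intro!: prod.cong)
  moreover have "1 - contention h \<le> 1 - (\<Sum>v\<in>alive A h - {u}. prob_send A h v)"
    unfolding contention_def by (simp add: sum_mono2 prob_send_bounds)
  moreover have "\<dots> \<le> (\<Prod>v\<in>alive A h - {u}. 1 - prob_send A h v)"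
    by (rule Weierstrass_prod_ineq) (simp add: prob_send_bounds)
  ultimately show ?thesis by (simp add: mult_left_mono prob_send_bounds)
qed

lemma prob_success:
  "contention h * (1 - contention h) \<le> (\<Sum>S | S \<in> Pow (alive A h) \<and> is_singleton S. prob_attempt A h S)"
proof -
  have *: "{S. S \<in> Pow (alive A h) \<and> is_singleton S} = (\<lambda>u. {u}) ` alive A h"
    by (auto simp: is_singleton_def)
  have "contention h * (1 - contention h) \<le> (\<Sum>u\<in>alive A h. prob_attempt A h {u})"
    by (subst contention_def) (simp add: sum_distrib_right sum_mono prob_attempt_singleton)
  also have "\<dots> = (\<Sum>S | S \<in> Pow (alive A h) \<and> is_singleton S. prob_attempt A h S)"
    unfolding * by (subst sum.reindex) auto
  finally show ?thesis .
qed

text \<open>A critical slot succeeds with probability at least 1/64, so halving at each success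
  contributes a mean factor of at most 127/128, which pays for the factor 128/127 per visit. With at
  most \<open>n\<close> successes, many visits force \<open>\<Phi>\<close> to be large.\<close>

lemma critical_visits_tail:
  assumes woken: "\<And>h. prob_history A h > 0 \<Longrightarrow> h \<in> histories A (length h) \<Longrightarrow> woken A h \<le> n"
  shows "measure \<Omega> {\<omega>. 256 * n \<le> visits critical (history A \<omega> t)} \<le> exp (- real n)"
proof -
  define \<Phi> where "\<Phi> h = (128 / 127) ^ visits critical h * (1 / 2 :: real) ^ successes h" for h
  have "measure \<Omega> {\<omega>. 256 * n \<le> visits critical (history A \<omega> t)}
      \<le> \<Phi> [] / ((128 / 127) ^ (256 * n) * (1 / 2) ^ n)"
  proof (rule supermartingale_Markov[where R = "\<lambda>h. 256 * n \<le> visits critical h"])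
    fix h
    assume h: "h \<in> histories A (length h)" "prob_history A h > 0"
    define q where "q = (\<Sum>S | S \<in> Pow (alive A h) \<and> is_singleton S. prob_attempt A h S)"
    have q: "q = (\<Sum>S\<in>Pow (alive A h). if is_singleton S then prob_attempt A h S else 0)"
      unfolding q_def by (rule sum.inter_filter) simp
    define \<alpha> where "\<alpha> = (if critical h then 128 / 127 else 1 :: real)"
    have "(\<Sum>S\<in>Pow (alive A h). prob_attempt A h S * \<Phi> (h @ [S])) =
        (\<Sum>S\<in>Pow (alive A h). \<alpha> * \<Phi> h * (prob_attempt A h S - (1 / 2) * (if is_singleton S then prob_attempt A h S else 0)))"
      by (intro sum.cong) (auto simp: \<Phi>_def \<alpha>_def visits_append successes_append)
    also have "\<dots> = \<alpha> * \<Phi> h * (1 - 1 / 2 * q)"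
      by (simp only: sum_distrib_left[symmetric] sum_subtractf sum_prob_attempt q)
    also have "\<dots> \<le> \<Phi> h * 1"
    proof -
      have "\<alpha> * (1 - 1 / 2 * q) \<le> 1"
      proof (cases "critical h")
        case True
        then have "1 / 32 * (1 / 2) \<le> contention h * (1 - contention h)"
          by (intro mult_mono) (auto simp: critical_def)
        then have "1 / 64 \<le> q" using prob_success[of h] by (simp add: q_def)
        then show ?thesis using True by (simp add: \<alpha>_def)
      next
        case False
        have "0 \<le> q" unfolding q_def by (intro sum_nonneg prob_attempt_nonneg)
        then show ?thesis using False by (simp add: \<alpha>_def)
      qed
      moreover have "0 \<le> \<Phi> h" by (simp add: \<Phi>_def)
      ultimately have "\<Phi> h * (\<alpha> * (1 - 1 / 2 * q)) \<le> \<Phi> h * 1" by (intro mult_left_mono)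
      then show ?thesis by (simp add: mult_ac)
    qed
    finally show "(\<Sum>S\<in>Pow (alive A h). prob_attempt A h S * \<Phi> (h @ [S])) \<le> \<Phi> h" by simp
  next
    fix h assume h: "h \<in> histories A t" "prob_history A h > 0" "256 * n \<le> visits critical h"
    then have h': "h \<in> histories A (length h)" by (simp add: histories_def)
    have "(128 / 127 :: real) ^ (256 * n) \<le> (128 / 127) ^ visits critical h"
      using h(3) by (intro power_increasing) auto
    moreover have "(1 / 2 :: real) ^ n \<le> (1 / 2) ^ successes h"
      using successes_le_woken[OF h'] woken[OF h(2) h'] by (intro power_decreasing) auto
    ultimately show "(128 / 127) ^ (256 * n) * (1 / 2) ^ n \<le> \<Phi> h"
      unfolding \<Phi>_def by (intro mult_mono) auto
  qed (simp_all add: \<Phi>_def)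
  also have "\<dots> = (2 * (127 / 128) ^ 256) ^ n"
  proof -
    have "1 / ((1 / a) ^ (256 * n) * (1 / 2) ^ n) = (2 * a ^ 256) ^ n" for a :: real
      by (simp add: power_mult power_mult_distrib power_one_over)
    from this[of "127 / 128"] show ?thesis by (simp only: \<Phi>_def visits_Nil successes_Nil) simp
  qed
  also have "\<dots> \<le> exp (- 1) ^ n"
  proof (intro power_mono)
    \<comment> \<open>From \<open>1 + z \<le> exp z\<close> the power is at most
      \<open>exp (- 2)\<close>, and the factor 2 is absorbed by
      \<open>2 \<le> exp 1\<close>.\<close>
    have "(1 + (- 1 / 128) :: real) ^ 256 \<le> exp (- 1 / 128) ^ 256"
      by (intro power_mono exp_ge_add_one_self) auto
    also have "\<dots> = exp (- 2)" by (simp flip: exp_of_nat_mult)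
    finally have "2 * (127 / 128 :: real) ^ 256 \<le> 2 * exp (- 2)" by simp
    also have "\<dots> \<le> exp 1 * exp (- 2)" using exp_ge_add_one_self[of "1 :: real"] by (intro mult_right_mono) auto
    also have "\<dots> = exp (- 1 :: real)" by (simp flip: exp_add)
    finally show "2 * (127 / 128) ^ 256 \<le> exp (- 1 :: real)" .
  qed simp
  also have "\<dots> = exp (- real n)" by (simp flip: exp_of_nat_mult)
  finally show ?thesis .
qed

text \<open>In a good slot \<open>u\<close> is alone with probability at least \<open>r / 2\<close>.
  The weight grows by \<open>1 / x\<close> per good slot and vanishes on timely success, so it is a
  supermartingale for \<open>x = 1 - r / 2\<close>.\<close>

lemma missed_tail:
  assumes r: "0 < r" "r \<le> 1"
    and good: "\<And>h. good h \<Longrightarrow> u \<in> alive A h \<and> length h \<le> woken_at A h u + T \<and>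
       r \<le> prob_send A h u \<and> contention h \<le> 1 / 2"
  shows "measure \<Omega> {\<omega>. missed A u T (history A \<omega> t) \<and> g \<le> visits good (history A \<omega> t)} \<le> exp (- r * real g / 2)"
proof -
  define x where "x = 1 - r / 2"
  have x: "0 < x" "x \<le> 1" using r by (auto simp: x_def)
  define \<Psi> where "\<Psi> h = (if missed A u T h then (1 / x) ^ visits good h else 0)" for h
  have "measure \<Omega> {\<omega>. missed A u T (history A \<omega> t) \<and> g \<le> visits good (history A \<omega> t)} \<le> \<Psi> [] / (1 / x) ^ g"
  proof (rule supermartingale_Markov[where R = "\<lambda>h. missed A u T h \<and> g \<le> visits good h"])
    fix h
    assume h: "h \<in> histories A (length h)" "prob_history A h > 0"
    show "(\<Sum>S\<in>Pow (alive A h). prob_attempt A h S * \<Psi> (h @ [S])) \<le> \<Psi> h"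
    proof (cases "good h")
      case True
      note good = good[OF True]
      have "r * (1 / 2) \<le> prob_send A h u * (1 - contention h)"
        using good r by (intro mult_mono) auto
      then have "r / 2 \<le> prob_attempt A h {u}"
        using prob_attempt_singleton[of u h] good by linarith
      then have le: "1 - prob_attempt A h {u} \<le> x" by (simp add: x_def)
      \<comment> \<open>A good slot lies within the deadline, so the summand for
        \<open>S = {u}\<close> vanishes.\<close>
      have "(\<Sum>S\<in>Pow (alive A h). prob_attempt A h S * \<Psi> (h @ [S])) =
          (\<Sum>S\<in>Pow (alive A h). 1 / x * \<Psi> h * (prob_attempt A h S - (if S = {u} then prob_attempt A h S else 0)))"
        using good True by (intro sum.cong) (auto simp: \<Psi>_def visits_append missed_append)
      also have "\<dots> = 1 / x * \<Psi> h * (1 - prob_attempt A h {u})"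
        using good by (simp only: sum_distrib_left[symmetric] sum_subtractf sum_prob_attempt)
          (simp add: sum.delta)
      also have "\<dots> \<le> 1 / x * \<Psi> h * x"
        using le x by (intro mult_left_mono) (auto simp: \<Psi>_def)
      finally show ?thesis using x by simp
    next
      case False
      have "(\<Sum>S\<in>Pow (alive A h). prob_attempt A h S * \<Psi> (h @ [S])) \<le> (\<Sum>S\<in>Pow (alive A h). prob_attempt A h S * \<Psi> h)"
        using False x by (intro sum_mono mult_left_mono prob_attempt_nonneg)
          (auto simp: \<Psi>_def visits_append missed_append)
      also have "\<dots> = \<Psi> h" by (simp add: sum_distrib_right[symmetric] sum_prob_attempt)
      finally show ?thesis .
    qed
  next
    fix h assume "missed A u T h \<and> g \<le> visits good h"
    then show "(1 / x) ^ g \<le> \<Psi> h"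
      using x by (auto simp: \<Psi>_def intro!: power_increasing)
  qed (use x in \<open>auto simp: \<Psi>_def\<close>)
  also have "\<dots> = x ^ g" by (simp add: \<Psi>_def power_divide)
  also have "\<dots> \<le> exp (- r / 2) ^ g"
    using x exp_ge_add_one_self[of "- r / 2"] by (intro power_mono) (auto simp: x_def)
  also have "\<dots> = exp (- r * real g / 2)" by (simp add: mult_ac flip: exp_of_nat_mult)
  finally show ?thesis .
qed

text \<open>Turns the almost sure condition into one on single records: \<open>woken\<close> never
  decreases, so a record of positive probability with more than \<open>n\<close> parties would
  contradict it.\<close>

lemma woken_le_total:
  assumes "wakes_up bit_law n A" "h \<in> histories A (length h)" "prob_history A h > 0"
  shows "woken A h \<le> n"
proof (rule ccontr)
  assume n: "\<not> woken A h \<le> n"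
  interpret prob_space \<Omega> by (rule prob_space_sample)
  have "AE \<omega> in \<Omega>. \<omega> \<notin> {\<omega>. history A \<omega> (length h) = h}"
    using assms(1) unfolding wakes_up_def
  proof (rule AE_mp, intro AE_I2 impI)
    fix \<omega> assume "\<forall>\<^sub>F t in sequentially. woken A (history A \<omega> t) = n"
    then obtain t where t: "\<And>t'. t \<le> t' \<Longrightarrow> woken A (history A \<omega> t') = n"
      by (auto simp: eventually_sequentially)
    show "\<omega> \<notin> {\<omega>. history A \<omega> (length h) = h}"
    proof
      assume "\<omega> \<in> {\<omega>. history A \<omega> (length h) = h}"
      then have "take (length h) (history A \<omega> (t + length h)) = h" by (simp add: take_history)
      then have "woken A h \<le> woken A (history A \<omega> (t + length h))" by (metis woken_take_le)
      then show False using t[of "t + length h"] n by simp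
    qed
  qed
  then have "prob {\<omega>. history A \<omega> (length h) = h} = 0"
    using prob_history(1)[OF assms(2)] by (simp add: prob_eq_0)
  then show False using prob_history(2)[OF assms(2)] assms(3) by simp
qed

end

end

section \<open>Contention at the levels\<close>

(* decay 0 = 0, as x/0 = 0, so suminf decay sums over the ages a >= 1 *)
definition decay :: "nat \<Rightarrow> real" where
  "decay a = 1 / (real a * (1 + log 2 (real a)) ^ 2)"

definition send_rate :: "nat \<Rightarrow> nat \<Rightarrow> real" where
  "send_rate i a = min 1 (2 ^ i * decay a)"

lemma decay_nonneg: "0 \<le> decay a"
  by (simp add: decay_def)

lemma decay_pos: "0 < a \<Longrightarrow> 0 < decay a"
  by (auto simp: decay_def intro!: divide_pos_pos mult_pos_pos zero_less_power add_pos_nonneg)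

lemma decay_antimono: "decay b \<le> decay a" if "0 < a" "a \<le> b"
proof -
  have "real a * (1 + log 2 (real a)) ^ 2 \<le> real b * (1 + log 2 (real b)) ^ 2"
    using that by (intro mult_mono power_mono) auto
  moreover have "0 < real a * (1 + log 2 (real a)) ^ 2"
    using that by (auto intro!: mult_pos_pos zero_less_power add_pos_nonneg)
  ultimately show ?thesis by (simp add: decay_def divide_left_mono frac_le)
qed

text \<open>Doubling the age at most doubles the linear factor and, as
  \<open>2 + log 2 a \<le> 2 * (1 + log 2 a)\<close>, at most quadruples the square.\<close>

lemma decay_double: "decay a / 8 \<le> decay b" if "0 < a" "a \<le> b" "b \<le> 2 * a"
proof -
  have "real b * (1 + log 2 (real b)) ^ 2 \<le> (2 * real a) * (1 + log 2 (2 * real a)) ^ 2"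
    using that by (intro mult_mono power_mono add_left_mono) auto
  also have "\<dots> = 2 * real a * (2 + log 2 (real a)) ^ 2"
    using that by (simp add: log_mult)
  also have "\<dots> \<le> 2 * real a * (2 * (1 + log 2 (real a))) ^ 2"
    using that by (intro mult_left_mono power_mono) auto
  also have "\<dots> = 8 * (real a * (1 + log 2 (real a)) ^ 2)" by (simp only: power_mult_distrib) simp
  finally have "1 / (8 * (real a * (1 + log 2 (real a)) ^ 2)) \<le> decay b"
    unfolding decay_def using that
    by (intro divide_left_mono mult_pos_pos zero_less_power add_pos_nonneg) auto
  then show ?thesis by (simp add: decay_def)
qed

text \<open>Cauchy condensation leads to the sum of \<open>1 / (n + 1) ^ 2\<close>.\<close>

lemma summable_decay: "summable decay"
proof -
  have "summable (\<lambda>n. 1 / real (Suc n) ^ 2)"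
    using inverse_power_summable[of 2, where 'a = real] by (subst summable_Suc_iff) (simp add: divide_inverse)
  moreover have "2 ^ n * decay (2 ^ n) = 1 / real (Suc n) ^ 2" for n
    by (simp add: decay_def add.commute)
  ultimately have "summable (\<lambda>n. 2 ^ n * decay (2 ^ n))" by simp
  then show ?thesis
    by (subst condensation_test) (auto intro: decay_antimono decay_nonneg)
qed

lemma send_rate_nonneg: "0 \<le> send_rate i a"
  by (simp add: send_rate_def decay_nonneg)

lemma send_rate_antimono: "send_rate i b \<le> send_rate i a" if "0 < a" "a \<le> b"
  unfolding send_rate_def using decay_antimono[OF that] by (intro min.mono mult_left_mono) auto

text \<open>Ensures that contention cannot jump over the interval from 1/4 to 1/2 between
  consecutive levels.\<close>

lemma send_rate_Suc: "send_rate (Suc i) a \<le> 2 * send_rate i a"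
  using decay_nonneg[of a] by (simp add: send_rate_def min_def)

lemma send_rate_double: "send_rate i a / 8 \<le> send_rate i b" if "0 < a" "a \<le> b" "b \<le> 2 * a"
proof -
  have "2 ^ i * (decay a / 8) \<le> 2 ^ i * decay b" using decay_double[OF that] by (intro mult_left_mono) auto
  moreover have "min 1 x / 8 \<le> min 1 y" if "x / 8 \<le> y" for x y :: real
    using that by (auto simp: min_def)
  ultimately show ?thesis by (simp add: send_rate_def)
qed

text \<open>The protocol of the theorem; the global clock enters only through
  \<open>level s\<close>.\<close>

interpretation cr: oblivious_protocol "\<lambda>s. send_rate (level s)"
  by standard (rule send_rate_nonneg, simp add: send_rate_def)

definition listening_slot :: "strategy \<Rightarrow> nat \<Rightarrow> nat \<Rightarrow> nat \<Rightarrow> nat set list \<Rightarrow> bool" where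
  "listening_slot A u I T h \<longleftrightarrow> level (length h) = I \<and> u \<in> alive A h \<and>
     length h \<le> woken_at A h u + T \<and> cr.contention A h \<le> 1 / 2"

text \<open>Take the predecessor of the first index at which \<open>C\<close> exceeds 1/2.\<close>

lemma doubling_crossing:
  fixes C :: "nat \<Rightarrow> real"
  assumes "C 0 \<le> 1 / 2" "1 / 2 < C I" "\<And>i. C (Suc i) \<le> 2 * C i"
  obtains i where "i \<le> I" "1 / 4 < C i" "C i \<le> 1 / 2"
proof -
  define j where "j = (LEAST j. 1 / 2 < C j)"
  have j: "1 / 2 < C j" "j \<le> I" unfolding j_def by (rule LeastI, fact) (rule Least_le, fact)
  then obtain i where i: "j = Suc i" using assms(1) by (cases j) auto
  then have "\<not> 1 / 2 < C i" using not_less_Least[of i "\<lambda>j. 1 / 2 < C j"] by (auto simp: j_def)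
  then show ?thesis using j i assms(3)[of i] by (intro that[of i]) auto
qed

section \<open>Counting blocks of each kind\<close>

lemma card_arrivals: "card {s. s < length h \<and> 0 < A (take (Suc s) h)} \<le> woken A h"
proof -
  have "card {s. s < length h \<and> 0 < A (take (Suc s) h)} = (\<Sum>s | s < length h \<and> 0 < A (take (Suc s) h). 1)"
    by simp
  also have "\<dots> \<le> (\<Sum>s | s < length h \<and> 0 < A (take (Suc s) h). A (take (Suc s) h))"
    by (intro sum_mono) auto
  also have "\<dots> \<le> (\<Sum>s<length h. A (take (Suc s) h))"
    by (intro sum_mono2) auto
  finally show ?thesis by (simp add: woken_def)
qed

lemma arrival_at_woken_at:
  assumes "v < woken A h"
  shows "0 < A (take (Suc (woken_at A h v)) h)"
proof -
  note props = woken_at_props[OF assms]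
  have "woken A (take (Suc (woken_at A h v)) h) = woken A (take (woken_at A h v) h) + A (take (Suc (woken_at A h v)) h)"
    using props(1) by (simp add: woken_take)
  then show ?thesis using props by linarith
qed

text \<open>At different block starts a party has different ages, so the values are distinct terms
  of the series.\<close>

lemma sum_decay_le:
  assumes "finite M" "0 < P"
  shows "(\<Sum>m | m \<in> M \<and> w < m * P. decay (m * P - w)) \<le> suminf decay"
proof -
  let ?M = "{m. m \<in> M \<and> w < m * P}"
  have "inj_on (\<lambda>m. m * P - w) ?M"
  proof (rule inj_onI)
    fix a b assume "a \<in> ?M" "b \<in> ?M" "a * P - w = b * P - w"
    then have "a * P = b * P" by (simp add: eq_diff_iff)
    then show "a = b" using assms(2) by simp
  qed
  then have "(\<Sum>m\<in>?M. decay (m * P - w)) = (\<Sum>a\<in>(\<lambda>m. m * P - w) ` ?M. decay a)"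
    by (simp add: sum.reindex)
  also have "\<dots> \<le> suminf decay"
    using assms(1) by (intro sum_le_suminf summable_decay) (auto simp: decay_nonneg)
  finally show ?thesis .
qed

text \<open>Double counting: each party adds at most \<open>suminf decay\<close> to the level-0
  contention summed over all block starts, and a crowded block takes more than 1/4 of it.\<close>

lemma card_crowded:
  assumes M: "finite M" and P: "0 < P" and woken: "woken A h \<le> n"
  shows "real (card {m \<in> M. 1 / 4 < (\<Sum>v\<in>alive A (take (m * P) h). send_rate 0 (m * P - woken_at A h v))})
     \<le> 4 * suminf decay * n"
proof -
  let ?w = "woken_at A h"
  let ?C = "\<lambda>m. \<Sum>v\<in>alive A (take (m * P) h). send_rate 0 (m * P - ?w v)"
  let ?S = "{m \<in> M. 1 / 4 < ?C m}"
  have alive: "v < woken A h \<and> ?w v < m * P" if "v \<in> alive A (take (m * P) h)" for v m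
  proof -
    have *: "v < woken A (take (m * P) h)" using that by (rule alive_less_woken)
    then show ?thesis
      using woken_at_props(1)[OF *] woken_at_take[OF *] woken_take_le[of A "m * P" h] by auto
  qed
  have "real (card ?S) * (1 / 4) = (\<Sum>m\<in>?S. 1 / 4)" by simp
  also have "\<dots> \<le> (\<Sum>m\<in>?S. ?C m)" by (intro sum_mono) auto
  also have "\<dots> \<le> (\<Sum>m\<in>M. ?C m)"
    using M by (intro sum_mono2) (auto intro!: sum_nonneg send_rate_nonneg)
  also have "\<dots> \<le> (\<Sum>m\<in>M. \<Sum>v | v \<in> {..<woken A h} \<and> ?w v < m * P. decay (m * P - ?w v))"
  proof (rule sum_mono)
    fix m
    have "?C m \<le> (\<Sum>v\<in>alive A (take (m * P) h). decay (m * P - ?w v))"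
      by (intro sum_mono) (simp add: send_rate_def)
    also have "\<dots> \<le> (\<Sum>v | v \<in> {..<woken A h} \<and> ?w v < m * P. decay (m * P - ?w v))"
      using alive by (intro sum_mono2) (auto simp: decay_nonneg)
    finally show "?C m \<le> (\<Sum>v | v \<in> {..<woken A h} \<and> ?w v < m * P. decay (m * P - ?w v))" .
  qed
  also have "\<dots> = (\<Sum>v<woken A h. \<Sum>m | m \<in> M \<and> ?w v < m * P. decay (m * P - ?w v))"
    by (rule sum.swap_restrict) (use M in auto)
  also have "\<dots> \<le> (\<Sum>v<woken A h. suminf decay)"
    by (intro sum_mono sum_decay_le M P)
  also have "\<dots> \<le> n * suminf decay"
    using woken suminf_nonneg[OF summable_decay] decay_nonneg by (simp add: mult_right_mono)
  finally have "real (card ?S) * (1 / 4) \<le> n * suminf decay" .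
  then have "real (card ?S) \<le> 4 * (n * suminf decay)" by linarith
  then show ?thesis by (simp only: mult_ac)
qed

lemma card_div_image_le: "card ((\<lambda>s. s div P) ` {s. s < (k::nat) \<and> R s}) \<le> card {s. s < k \<and> R s}"
  by (intro card_image_le) auto

(* Each of the B * n blocks of the window contains an arrival, follows a block with an arrival,
   starts with level-0 contention above 1/4, contains a success, contains a critical slot, or
   contains a slot in which u is heard with constant probability if it sends.  Without arrivals
   and successes the alive parties are constant on the block and their ages at most double, so
   the contention of every level varies by a factor of at most 8. *)
lemma block_count:
  assumes h: "h \<in> histories A (length h)" and n: "woken A h \<le> n" and u: "u < woken A h"
    and missed: "missed A u T h" and T: "T = 2 ^ code_len I * (B * n + 1)"
    and window: "woken_at A h u + T < length h"
  shows "real (B * n) \<le> (3 + 4 * suminf decay) * n + visits (cr.critical A) h + visits (listening_slot A u I T) h"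
proof -
  define P :: nat where "P = 2 ^ code_len I"
  let ?w = "woken_at A h"
  \<comment> \<open>Whole blocks after the one containing the wake-up slot of \<open>u\<close>. The
    remainder of that block accounts for the \<open>+ 1\<close> in \<open>T\<close>.\<close>
  define M where "M = {?w u div P + 1..<?w u div P + 1 + B * n}"
  let ?C = "\<lambda>i m. \<Sum>v\<in>alive A (take (m * P) h). send_rate i (m * P - ?w v)"
  define Arr where "Arr = (\<lambda>s. s div P) ` {s. s < length h \<and> 0 < A (take (Suc s) h)}"
  define Crd where "Crd = {m \<in> M. 1 / 4 < ?C 0 m}"
  define Sing where "Sing = (\<lambda>s. s div P) ` {s. s < length h \<and> is_singleton (h ! s)}"
  define Crit where "Crit = (\<lambda>s. s div P) ` {s. s < length h \<and> cr.critical A (take s h)}"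
  define Good where "Good = (\<lambda>s. s div P) ` {s. s < length h \<and> listening_slot A u I T (take s h)}"
  have P: "0 < P" by (simp add: P_def)
  have "M \<subseteq> Arr \<union> (+) 1 ` Arr \<union> Crd \<union> Sing \<union> Crit \<union> Good"
  proof (rule subsetI, rule ccontr)
    fix m assume m: "m \<in> M" and notin: "m \<notin> Arr \<union> (+) 1 ` Arr \<union> Crd \<union> Sing \<union> Crit \<union> Good"
    have start: "?w u < m * P"
      using m P by (auto simp: M_def Suc_le_eq div_less_iff_less_mult)
    have "(m + 1) * P \<le> (?w u div P + (B * n + 1)) * P"
      using m by (intro mult_right_mono) (auto simp: M_def)
    also have "\<dots> \<le> ?w u + T" by (simp add: T P_def algebra_simps)
    finally have stop: "m * P + P \<le> ?w u + T" by simp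
    have block: "s div P = m" if "m * P \<le> s" "s < m * P + P" for s
      using that by (intro div_nat_eqI) (auto simp: mult.commute)
    have no_arrival: "A (take (Suc s) h) = 0" if "m * P \<le> s" "s < m * P + P" for s
      using notin block[OF that] stop window that by (force simp: Arr_def)
    have no_success: "\<not> is_singleton (h ! s)" if "m * P \<le> s" "s < m * P + P" for s
      using notin block[OF that] stop window that by (force simp: Sing_def)
    have alive_eq: "alive A (take s h) = alive A (take (m * P) h)" if s: "m * P \<le> s" "s < m * P + P" for s
    proof -
      have "{..<s} = {..<m * P} \<union> {m * P..<s}" using s by auto
      then have "woken A (take s h) = woken A (take (m * P) h) + (\<Sum>r=m * P..<s. A (take (Suc r) h))"
        using s stop window by (simp add: woken_take sum.union_disjoint ivl_disj_int)
      also have "(\<Sum>r=m * P..<s. A (take (Suc r) h)) = 0" using no_arrival s by simp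
      finally have "woken A (take s h) = woken A (take (m * P) h)" by simp
      moreover have "{v} \<in> set (take s h) \<longleftrightarrow> {v} \<in> set (take (m * P) h)" for v
      proof
        assume "{v} \<in> set (take s h)"
        then obtain r where r: "r < s" "r < length h" "h ! r = {v}" by (auto simp: in_set_conv_nth)
        then have "r < m * P" using no_success[of r] s by (force simp: not_less)
        then show "{v} \<in> set (take (m * P) h)"
          using r nth_mem[of r "take (m * P) h"] by simp
      next
        assume "{v} \<in> set (take (m * P) h)"
        then show "{v} \<in> set (take s h)" using set_take_subset_set_take[OF s(1), of h] by blast
      qed
      ultimately show ?thesis by (simp add: alive_def)
    qed
    \<comment> \<open>Neither block \<open>m\<close> nor the one before it has an arrival, so every
      alive party is at least one block old and its age at most doubles within block
      \<open>m\<close>.\<close>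
    have age: "?w v + P \<le> m * P" if v: "v \<in> alive A (take (m * P) h)" for v
    proof -
      have v': "v < woken A (take (m * P) h)" using v by (rule alive_less_woken)
      have less: "?w v < m * P" "?w v < length h"
        using woken_at_props(1)[OF v'] woken_at_take[OF v'] by auto
      have v'': "v < woken A h" using v' woken_take_le[of A "m * P" h] by simp
      have "?w v div P \<in> Arr" using arrival_at_woken_at[OF v''] less by (auto simp: Arr_def)
      then have "m \<noteq> 1 + ?w v div P" using notin by auto
      moreover have "?w v div P < m" using less P by (simp add: div_less_iff_less_mult)
      ultimately have "?w v div P + 2 \<le> m" by simp
      then have "(?w v div P + 2) * P \<le> m * P" by (rule mult_right_mono) simp
      moreover have "?w v < (?w v div P + 1) * P" using P dividend_less_div_times[of P "?w v"] by (simp add: algebra_simps)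
      ultimately show ?thesis by (simp add: algebra_simps)
    qed
    have contention: "cr.contention A (take s h) = (\<Sum>v\<in>alive A (take (m * P) h). send_rate (level s) (s - ?w v))"
      if s: "m * P \<le> s" "s < m * P + P" for s
      unfolding cr.contention_def alive_eq[OF s]
    proof (rule sum.cong)
      fix v assume "v \<in> alive A (take (m * P) h)"
      then have "v < woken A (take s h)" using alive_eq[OF s] alive_less_woken by blast
      then have "woken_at A (take s h) v = ?w v" using woken_at_take by metis
      moreover have "min (length h) s = s" using s stop window by simp
      ultimately show "cr.prob_send A (take s h) v = send_rate (level s) (s - ?w v)"
        by (simp add: cr.prob_send_def)
    qed simp
    have upper: "cr.contention A (take s h) \<le> ?C (level s) m" if s: "m * P \<le> s" "s < m * P + P" for s
      unfolding contention[OF s]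
    proof (rule sum_mono)
      fix v assume "v \<in> alive A (take (m * P) h)"
      from age[OF this] show "send_rate (level s) (s - ?w v) \<le> send_rate (level s) (m * P - ?w v)"
        using s P by (intro send_rate_antimono) auto
    qed
    have lower: "?C (level s) m / 8 \<le> cr.contention A (take s h)" if s: "m * P \<le> s" "s < m * P + P" for s
      unfolding contention[OF s] sum_divide_distrib
    proof (rule sum_mono)
      fix v assume "v \<in> alive A (take (m * P) h)"
      from age[OF this] show "send_rate (level s) (m * P - ?w v) / 8 \<le> send_rate (level s) (s - ?w v)"
        using s P by (intro send_rate_double) auto
    qed
    have in_window: "s < length h" "s \<le> ?w u + T" "?w u < s" if "m * P \<le> s" "s < m * P + P" for s
      using that stop window start by auto
    show False
    proof (cases "?C I m \<le> 1 / 2")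
      case True
      obtain s where "m * P \<le> s" "s < Suc m * P" "level s = I"
        by (rule level_in_block[of I I m, folded P_def, OF order_refl])
      then have s: "m * P \<le> s" "s < m * P + P" "level s = I" by simp_all
      note iw = in_window[OF s(1,2)]
      have "u < woken A (take (Suc (?w u)) h)" by (rule woken_at_props(2)[OF u])
      then have us: "u < woken A (take s h)"
        using woken_take_mono[of "Suc (?w u)" s A h] iw(3) by simp
      \<comment> \<open>An earlier success of \<open>u\<close> would lie within its deadline,
        against \<open>missed\<close>.\<close>
      have "{u} \<notin> set (take s h)"
      proof
        assume "{u} \<in> set (take s h)"
        then obtain r where r: "r < s" "r < length h" "h ! r = {u}" by (auto simp: in_set_conv_nth)
        have "u \<in> alive A (take r h)" using h r by (auto simp: histories_def)
        then have "woken_at A (take r h) u = ?w u" using woken_at_take alive_less_woken by metis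
        then have "?w u + T < r" using missed r by (auto simp: missed_def)
        then show False using r(1) iw(2) by simp
      qed
      then have "u \<in> alive A (take s h)" using us by (simp add: alive_def)
      moreover have "woken_at A (take s h) u = ?w u" using woken_at_take[OF us] by simp
      moreover have "cr.contention A (take s h) \<le> 1 / 2" using upper[OF s(1,2)] s(3) True by simp
      ultimately have "listening_slot A u I T (take s h)"
        using s(3) iw by (simp add: listening_slot_def min_absorb2)
      then have "m \<in> Good" using block[OF s(1,2)] iw(1) by (force simp: Good_def)
      then show False using notin by simp
    next
      case False
      have low: "?C 0 m \<le> 1 / 2" using notin m by (auto simp: Crd_def not_less)
      have high: "1 / 2 < ?C I m" using False by simp
      have double: "?C (Suc i) m \<le> 2 * ?C i m" for i
        unfolding sum_distrib_left by (intro sum_mono send_rate_Suc)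
      obtain i where i: "i \<le> I" "1 / 4 < ?C i m" "?C i m \<le> 1 / 2"
        by (rule doubling_crossing[of "\<lambda>i. ?C i m" I, OF low high double])
      obtain s where "m * P \<le> s" "s < Suc m * P" "level s = i"
        by (rule level_in_block[OF i(1), of m, folded P_def])
      then have s: "m * P \<le> s" "s < m * P + P" "level s = i" by simp_all
      have "cr.critical A (take s h)"
        using upper[OF s(1,2)] lower[OF s(1,2)] i s(3) by (simp add: cr.critical_def)
      then have "m \<in> Crit" using block[OF s(1,2)] in_window(1)[OF s(1,2)] by (force simp: Crit_def)
      then show False using notin by simp
    qed
  qed
  then have "card M \<le> card (Arr \<union> (+) 1 ` Arr \<union> Crd \<union> Sing \<union> Crit \<union> Good)"
    by (intro card_mono) (auto simp: Arr_def Crd_def M_def Sing_def Crit_def Good_def)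
  also have "\<dots> \<le> card Arr + card ((+) 1 ` Arr) + card Crd + card Sing + card Crit + card Good"
    by (meson add_le_mono1 card_Un_le order_trans)
  finally have "B * n \<le> card Arr + card ((+) 1 ` Arr) + card Crd + card Sing + card Crit + card Good"
    by (simp add: M_def)
  moreover have "card Arr \<le> n"
    using card_div_image_le card_arrivals[of h A] n unfolding Arr_def by (meson order_trans)
  moreover have "card ((+) 1 ` Arr) \<le> card Arr"
    by (intro card_image_le) (simp add: Arr_def)
  moreover have "card Sing \<le> n"
    using card_div_image_le successes_le_woken[OF h] n unfolding Sing_def successes_def by (meson order_trans)
  moreover have "card Crit \<le> visits (cr.critical A) h" "card Good \<le> visits (listening_slot A u I T) h"
    unfolding Crit_def Good_def visits_def by (rule card_div_image_le)+
  \<comment> \<open>The three copies of \<open>n\<close> bound \<open>Arr\<close>, its shift and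
    \<open>Sing\<close>.\<close>
  ultimately have "B * n \<le> 3 * n + card Crd + visits (cr.critical A) h + visits (listening_slot A u I T) h"
    by linarith
  then have "real (B * n) \<le>
      real (3 * n + card Crd + visits (cr.critical A) h + visits (listening_slot A u I T) h)"
    by (simp only: of_nat_le_iff)
  moreover have "real (card Crd) \<le> 4 * suminf decay * n"
    unfolding Crd_def using P n by (intro card_crowded) (auto simp: M_def)
  ultimately show ?thesis by (simp add: algebra_simps)
qed

section \<open>Latency\<close>

context oblivious_protocol
begin

text \<open>The implication is asked only of records with positive probability, since
  \<open>woken_le_total\<close> speaks only of those.\<close>

lemma measure_history_mono:
  assumes "\<And>h. h \<in> histories A t \<Longrightarrow> prob_history A h > 0 \<Longrightarrow> R h \<Longrightarrow> R' h"
  shows "measure \<Omega> {\<omega>. R (history A \<omega> t)} \<le> measure \<Omega> {\<omega>. R' (history A \<omega> t)}"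
proof -
  have "(\<Sum>h | h \<in> histories A t \<and> R h. prob_history A h) = (\<Sum>h | h \<in> histories A t \<and> R h \<and> R' h. prob_history A h)"
    using assms prob_history_nonneg[of A] by (intro sum.mono_neutral_right) (auto simp: less_le)
  also have "\<dots> \<le> (\<Sum>h | h \<in> histories A t \<and> R' h. prob_history A h)"
    by (intro sum_mono2) (auto simp: prob_history_nonneg)
  finally show ?thesis by (simp add: measure_history)
qed

lemma latency_le_iff:
  "latency A \<omega> u \<le> enat T \<longleftrightarrow> (\<exists>s\<le>wake_time A \<omega> u + T. attempting A \<omega> (history A \<omega> s) = {u})"
proof -
  \<comment> \<open>Subtracting a finite number from infinity leaves infinity, so a party that never
    succeeds fails both sides.\<close>
  have le: "x - enat w \<le> enat T \<longleftrightarrow> x \<le> enat (w + T)" for x w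
    by (cases x) auto
  have Inf: "Inf X \<le> enat k \<longleftrightarrow> (\<exists>x\<in>X. x \<le> enat k)" for X :: "enat set" and k
  proof
    assume *: "Inf X \<le> enat k"
    then have "X \<noteq> {}" by (auto simp: Inf_enat_def)
    then have "Inf X \<in> X" by (auto simp: Inf_enat_def intro: LeastI)
    with * show "\<exists>x\<in>X. x \<le> enat k" by blast
  qed (meson Inf_lower order_trans)
  show ?thesis unfolding latency_def success_time_def le Inf by (auto, metis enat_ord_simps(1))
qed

lemma sets_latency: "{\<omega>. latency A \<omega> u \<le> enat T} \<in> sets \<Omega>"
proof -
  have 1: "Measurable.pred \<Omega> (\<lambda>\<omega>. R (history A \<omega> t))" for R t
    using sets_history[of R A t] by (simp add: pred_def)
  have "(\<lambda>\<omega>. wake_time A \<omega> u) \<in> \<Omega> \<rightarrow>\<^sub>M count_space UNIV"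
    unfolding wake_time_def wake_slot_def by (intro measurable_Least 1)
  moreover have "Measurable.pred \<Omega> (\<lambda>\<omega>. attempting A \<omega> (history A \<omega> s) = {u})" for s
    using 1[of "\<lambda>h. h ! s = {u}" "Suc s"] by (simp add: nth_append)
  ultimately have "Measurable.pred \<Omega> (\<lambda>\<omega>. \<exists>s w. wake_time A \<omega> u = w \<and> s \<le> w + T \<and> attempting A \<omega> (history A \<omega> s) = {u})"
    by measurable
  then show ?thesis by (simp add: pred_def latency_le_iff)
qed

text \<open>The failure events increase with \<open>t\<close>, so a bound uniform in
  \<open>t\<close> passes to their union; outside it the latency is almost surely at most
  \<open>T\<close>.\<close>

lemma latency_tail:
  assumes wakes: "wakes_up bit_law n A" and u: "u < n"
    and bound: "\<And>t. measure \<Omega> {\<omega>. u < woken A (history A \<omega> t) \<and>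
        woken_at A (history A \<omega> t) u + T < t \<and> missed A u T (history A \<omega> t)} \<le> q"
  shows "1 - q \<le> measure \<Omega> {\<omega>. latency A \<omega> u \<le> enat T}"
proof -
  interpret prob_space \<Omega> by (rule prob_space_sample)
  define F where "F t = {\<omega>. u < woken A (history A \<omega> t) \<and>
        woken_at A (history A \<omega> t) u + T < t \<and> missed A u T (history A \<omega> t)}" for t
  let ?X = "{\<omega>. latency A \<omega> u \<le> enat T}"
  have sets_F: "F t \<in> sets \<Omega>" for t
    unfolding F_def by (rule sets_history[where R = "\<lambda>h. u < woken A h \<and> woken_at A h u + T < t \<and> missed A u T h"])
  have "incseq F"
  proof (rule incseq_SucI, rule subsetI)
    fix t \<omega> assume "\<omega> \<in> F t"
    then show "\<omega> \<in> F (Suc t)"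
      using woken_take_le[of A t "history A \<omega> (Suc t)"]
      by (auto simp: F_def woken_at_append missed_append)
  qed
  then have "(\<lambda>t. prob (F t)) \<longlonglongrightarrow> prob (\<Union>t. F t)"
    using sets_F by (intro finite_Lim_measure_incseq) auto
  then have UF: "prob (\<Union>t. F t) \<le> q"
    by (rule LIMSEQ_le_const2) (use bound in \<open>auto simp: F_def\<close>)
  have "AE \<omega> in \<Omega>. \<omega> \<in> space \<Omega> - (\<Union>t. F t) \<longrightarrow> \<omega> \<in> ?X"
    using wakes unfolding wakes_up_def
  proof (rule AE_mp, intro AE_I2 impI)
    fix \<omega> assume "\<forall>\<^sub>F t in sequentially. woken A (history A \<omega> t) = n" and notF: "\<omega> \<in> space \<Omega> - (\<Union>t. F t)"
    then obtain t0 where t0: "\<And>t. t0 \<le> t \<Longrightarrow> woken A (history A \<omega> t) = n"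
      by (auto simp: eventually_sequentially)
    \<comment> \<open>A time after both the last wake-up and the deadline of
      \<open>u\<close>.\<close>
    define t where "t = Suc (max t0 (wake_time A \<omega> u + T))"
    have woken: "u < woken A (history A \<omega> t)" using t0[of t] u by (simp add: t_def)
    then have w: "woken_at A (history A \<omega> t) u = wake_time A \<omega> u" by (simp add: wake_time_eq)
    have "wake_time A \<omega> u + T < t" by (simp add: t_def)
    then have "\<not> missed A u T (history A \<omega> t)" using notF woken w by (auto simp: F_def)
    then obtain s where s: "s < t" "attempting A \<omega> (history A \<omega> s) = {u}"
        "\<not> woken_at A (history A \<omega> s) u + T < s"
      by (auto simp: missed_def nth_history take_history)
    then have "u < woken A (history A \<omega> s)"
      by (auto simp: attempting_eq alive_def)
    then have "s \<le> wake_time A \<omega> u + T" using s(3) by (simp add: wake_time_eq)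
    then show "\<omega> \<in> ?X" using s(2) by (auto simp: latency_le_iff)
  qed
  then have "prob (space \<Omega> - (\<Union>t. F t)) \<le> prob ?X"
    using sets_latency by (intro finite_measure_mono_AE) auto
  then show ?thesis
    using UF sets_F by (subst (asm) prob_compl) auto
qed

end

text \<open>The constant 260 is 3 + 256 + 1: after the \<open>3 * n\<close> blocks and the crowded
  ones of \<open>block_count\<close>, \<open>257 * n\<close> remain, so there are
  \<open>256 * n\<close> critical slots or \<open>n\<close> listening slots. Each case has its own
  tail bound.\<close>

lemma missed_window_tail:
  assumes wakes: "wakes_up cr.bit_law n A" and u: "u < n"
    and B: "260 + 4 * suminf decay \<le> real B" and T: "T = 2 ^ code_len I * (B * n + 1)"
  shows "measure cr.\<Omega> {\<omega>. u < woken A (history A \<omega> t) \<and>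
      woken_at A (history A \<omega> t) u + T < t \<and> missed A u T (history A \<omega> t)}
    \<le> exp (- real n) + exp (- send_rate I T * real n / 2)"
    (is "measure _ {\<omega>. ?F (history A \<omega> t)} \<le> _")
proof -
  let ?C = "\<lambda>h. 256 * n \<le> visits (cr.critical A) h"
  let ?G = "\<lambda>h. missed A u T h \<and> n \<le> visits (listening_slot A u I T) h"
  have "measure cr.\<Omega> {\<omega>. ?F (history A \<omega> t)} \<le> measure cr.\<Omega> {\<omega>. ?C (history A \<omega> t) \<or> ?G (history A \<omega> t)}"
  proof (rule cr.measure_history_mono)
    fix h assume h: "h \<in> histories A t" "cr.prob_history A h > 0" "?F h"
    then have h': "h \<in> histories A (length h)" "length h = t" by (auto simp: histories_def)
    have "real (B * n) \<le> (3 + 4 * suminf decay) * n + visits (cr.critical A) h + visits (listening_slot A u I T) h"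
      using h(3) h' cr.woken_le_total[OF wakes h'(1) h(2)] by (intro block_count[OF h'(1) _ _ _ T]) auto
    moreover have "(260 + 4 * suminf decay) * real n \<le> real B * real n" using B by (intro mult_right_mono) auto
    ultimately have "real (257 * n) \<le> real (visits (cr.critical A) h + visits (listening_slot A u I T) h)"
      by (simp add: algebra_simps)
    then have "257 * n \<le> visits (cr.critical A) h + visits (listening_slot A u I T) h"
      by (simp only: of_nat_le_iff)
    then show "?C h \<or> ?G h" using h(3) by linarith
  qed
  also have "\<dots> = measure cr.\<Omega> ({\<omega>. ?C (history A \<omega> t)} \<union> {\<omega>. ?G (history A \<omega> t)})"
    by (rule arg_cong[of _ _ "measure cr.\<Omega>"]) auto
  also have "\<dots> \<le> measure cr.\<Omega> {\<omega>. ?C (history A \<omega> t)} + measure cr.\<Omega> {\<omega>. ?G (history A \<omega> t)}"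
    by (intro measure_Un_le cr.sets_history)
  also have "\<dots> \<le> exp (- real n) + exp (- send_rate I T * real n / 2)"
  proof (rule add_mono)
    show "measure cr.\<Omega> {\<omega>. ?C (history A \<omega> t)} \<le> exp (- real n)"
      by (rule cr.critical_visits_tail) (use cr.woken_le_total[OF wakes] in blast)
    have T': "0 < T" by (simp add: T)
    show "measure cr.\<Omega> {\<omega>. ?G (history A \<omega> t)} \<le> exp (- send_rate I T * real n / 2)"
    proof (rule cr.missed_tail)
      show "0 < send_rate I T" "send_rate I T \<le> 1"
        using decay_pos[OF T'] by (auto simp: send_rate_def)
    next
      fix h assume h: "listening_slot A u I T h"
      then have "woken_at A h u < length h"
        by (intro woken_at_props(1) alive_less_woken) (auto simp: listening_slot_def)
      moreover have "length h \<le> woken_at A h u + T" using h by (simp add: listening_slot_def)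
      \<comment> \<open>Within the deadline the age is at most \<open>T\<close>, and the rate
        decreases with age.\<close>
      ultimately have "send_rate I T \<le> send_rate I (length h - woken_at A h u)"
        by (intro send_rate_antimono) auto
      then show "u \<in> alive A h \<and> length h \<le> woken_at A h u + T \<and>
          send_rate I T \<le> cr.prob_send A h u \<and> cr.contention A h \<le> 1 / 2"
        using h by (auto simp: listening_slot_def cr.prob_send_def)
    qed
  qed
  finally show ?thesis .
qed

lemma whp_latency_le:
  assumes B: "260 + 4 * suminf decay \<le> real B" and T: "T = 2 ^ code_len I * (B * n + 1)"
    and small: "exp (- real n) + exp (- send_rate I T * real n / 2) \<le> 1 / real n ^ 2"
  shows "whp_latency cr.bit_law n \<le> enat T"
  unfolding whp_latency_def protocol_latency_def
proof (rule Least_le, intro allI impI)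
  fix A u assume *: "wakes_up cr.bit_law n A" "u < n"
  show "1 - 1 / real n ^ 2 \<le> measure cr.\<Omega> {\<omega> \<in> space cr.\<Omega>. latency A \<omega> u \<le> enat T}"
    using cr.latency_tail[OF * order_trans[OF missed_window_tail[OF * B T] small]] by simp
qed

section \<open>Asymptotics in the number of parties\<close>

lemma filterlim_loglog: "filterlim (\<lambda>n. log 2 (log 2 (real n))) at_top sequentially"
  by real_asymp

text \<open>Here \<open>x\<close> stands for \<open>log 2 n\<close>. The right-hand side, of order
  \<open>x ^ 2 / (log 2 x) ^ 4\<close>, will bound the failure exponent from below.\<close>

lemma send_rate_window_ge:
  assumes c: "0 < (c::real)"
  shows "\<forall>\<^sub>F x in at_top. 3 * x \<le> x ^ 4 / (c * (log 2 x) ^ 4 * (1 + (log 2 c + x + 4 * log 2 (log 2 x))) ^ 2)"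
  using c by real_asymp

text \<open>A crude polynomial bound, enough for estimating \<open>decay\<close> at the end of the
  window; 1024 is \<open>2 * 2 * 4 ^ 4\<close>.\<close>

lemma window_length_le:
  assumes "2 \<le> I" "real I \<le> 4 * y" "1 \<le> n"
  shows "real (2 ^ code_len I * (B * n + 1)) \<le> 1024 * (real B + 1) * n * y ^ 4"
proof -
  have "2 ^ code_len I \<le> 2 * zeta (real I)" using assms by (intro two_power_code_len) auto
  also have "\<dots> \<le> 2 * (2 * real I ^ 4)" using assms by (intro mult_left_mono zeta_le_power) auto
  also have "\<dots> \<le> 2 * (2 * (4 * y) ^ 4)" using assms by (intro mult_left_mono power_mono) auto
  finally have "2 ^ code_len I \<le> 1024 * y ^ 4" by (simp add: power_mult_distrib)
  moreover have "real (B * n + 1) \<le> (real B + 1) * n" using assms by (simp add: algebra_simps)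
  ultimately have "2 ^ code_len I * real (B * n + 1) \<le> (1024 * y ^ 4) * ((real B + 1) * n)"
    by (intro mult_mono) auto
  then show ?thesis by (simp add: algebra_simps)
qed

text \<open>Occurs only in the analysis. For large \<open>n\<close>, \<open>2 ^ top_level n\<close>
  is \<open>(log 2 n) ^ 4\<close> up to a factor 2, which beats the two logarithms in
  \<open>decay\<close> with room to spare.\<close>

definition top_level :: "nat \<Rightarrow> nat" where
  "top_level n = nat \<lfloor>4 * log 2 (log 2 (real n))\<rfloor>"

lemma failure_prob_small:
  defines "T \<equiv> \<lambda>B n. 2 ^ code_len (top_level n) * (B * n + 1)"
  shows "\<forall>\<^sub>F n in sequentially.
    exp (- real n) + exp (- send_rate (top_level n) (T B n) * real n / 2) \<le> 1 / real n ^ 2"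
proof -
  \<comment> \<open>The 1024 of \<open>window_length_le\<close> times 4: one factor 2 from the
    exponent \<open>n / 2\<close>, one from the floor in \<open>top_level\<close>.\<close>
  define c where "c = 4096 * (real B + 1)"
  have c: "0 < c" by (simp add: c_def)
  have lim: "filterlim (\<lambda>n. log 2 (real n)) at_top sequentially" by real_asymp
  have "\<forall>\<^sub>F n in sequentially. 1 \<le> log 2 (log 2 (real n))" "\<forall>\<^sub>F n in sequentially. 6 * ln (real n) \<le> real n"
    "\<forall>\<^sub>F n in sequentially. (2::real) \<le> real n"
    by real_asymp+
  then show ?thesis using eventually_compose_filterlim[OF send_rate_window_ge[OF c] lim]
  proof eventually_elim
    case (elim n)
    define x where "x = log 2 (real n)"
    define y where "y = log 2 x"
    define I where "I = top_level n"
    have y: "1 \<le> y" using elim(1) by (simp add: x_def y_def)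
    have x0: "0 < x"
      using elim(3) by (simp add: x_def)
    have n: "2 \<le> n" using elim(3) by simp
    have I: "4 * y - 1 \<le> real I" "real I \<le> 4 * y"
      using y by (auto simp: I_def top_level_def x_def[symmetric] y_def[symmetric])
    have I2: "2 \<le> I" using I(1) y by linarith
    define Th where "Th = c / 4 * n * y ^ 4"
    have c4: "c / 4 = 1024 * (real B + 1)" by (simp add: c_def)
    have TB: "real (T B n) \<le> Th"
      using window_length_le[OF I2 I(2), of n B] n unfolding T_def I_def[symmetric] Th_def c4 by simp
    have "0 < T B n" by (simp add: T_def)
    then have T1: "1 \<le> T B n" by simp
    have Th1: "1 \<le> Th" using TB T1 by linarith
    have "log 2 Th = log 2 (c / 4) + x + 4 * log 2 y"
    proof -
      have "log 2 (k * n * y ^ 4) = log 2 k + x + 4 * log 2 y" if "0 < k" for k :: real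
        using that n y by (simp add: log_mult log_nat_power x_def)
      from this[of "c / 4"] show ?thesis using c unfolding Th_def by simp
    qed
    also have "\<dots> \<le> log 2 c + x + 4 * log 2 y" using c by simp
    finally have logTh: "log 2 Th \<le> log 2 c + x + 4 * log 2 y" .
    have "real (T B n) * (1 + log 2 (real (T B n))) ^ 2 \<le> Th * (1 + log 2 Th) ^ 2"
      using TB T1 by (intro mult_mono power_mono) auto
    also have "\<dots> \<le> Th * (1 + (log 2 c + x + 4 * log 2 y)) ^ 2"
      using logTh Th1 by (intro mult_left_mono power_mono) auto
    finally have D: "real (T B n) * (1 + log 2 (real (T B n))) ^ 2 \<le> Th * (1 + (log 2 c + x + 4 * log 2 y)) ^ 2" .
    have pos: "0 < real (T B n) * (1 + log 2 (real (T B n))) ^ 2"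
      using T1 by (intro mult_pos_pos zero_less_power add_pos_nonneg) auto
    have "x ^ 4 = 2 powr (4 * y)"
      using x0 powr_powr[of 2 y 4] by (simp add: y_def mult.commute powr_realpow[of x 4, simplified])
    also have "\<dots> \<le> 2 powr (1 + real I)" using I by (intro powr_mono) auto
    also have "\<dots> = 2 * 2 ^ I" by (simp add: powr_add powr_realpow)
    finally have I4: "x ^ 4 / 2 \<le> 2 ^ I" by simp
    have "x ^ 4 / 2 / (Th * (1 + (log 2 c + x + 4 * log 2 y)) ^ 2) \<le> 2 ^ I * decay (T B n)"
      using frac_le[OF _ I4 pos D] by (simp add: decay_def)
    then have "n / 2 * (x ^ 4 / 2 / (Th * (1 + (log 2 c + x + 4 * log 2 y)) ^ 2)) \<le> n / 2 * (2 ^ I * decay (T B n))"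
      by (intro mult_left_mono) auto
    moreover have "n / 2 * (x ^ 4 / 2 / (Th * (1 + (log 2 c + x + 4 * log 2 y)) ^ 2))
        = x ^ 4 / (c * y ^ 4 * (1 + (log 2 c + x + 4 * log 2 y)) ^ 2)"
      using n by (simp add: Th_def)
    ultimately have "3 * x \<le> n / 2 * (2 ^ I * decay (T B n))"
      using elim(4) by (simp add: x_def y_def)
    moreover have "ln n \<le> x"
    proof -
      have "ln n = x * ln 2" by (simp add: x_def log_def)
      also have "\<dots> \<le> x * 1" using x0 ln2_le_25_over_36 by (intro mult_left_mono) auto
      finally show ?thesis by simp
    qed
    \<comment> \<open>If the cap 1 in \<open>send_rate\<close> is attained, the bound
      \<open>6 * ln n \<le> n\<close> applies instead.\<close>
    ultimately have "3 * ln n \<le> send_rate I (T B n) * n / 2"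
      using elim(2) by (simp add: send_rate_def min_def mult_ac)
    then have "exp (- send_rate I (T B n) * n / 2) \<le> exp (- (3 * ln n))" by simp
    moreover have "0 \<le> ln (real n)" using n by simp
    then have "3 * ln n \<le> n" using elim(2) by linarith
    then have "exp (- real n) \<le> exp (- (3 * ln n))" by simp
    moreover have "exp (- (3 * ln n)) = 1 / real n ^ 3"
      using n exp_of_nat_mult[of 3 "ln (real n)"] by (simp add: exp_minus divide_inverse)
    moreover have "2 * (1 / real n ^ 3) \<le> 1 / real n ^ 2"
      using n by (simp add: power2_eq_square power3_eq_cube field_simps)
    ultimately show ?case unfolding I_def by linarith
  qed
qed

text \<open>\<open>\<delta>\<close> solves \<open>zeta (4 * x) = x powr (1 + \<delta> x)\<close>. As
  \<open>zeta (4 * x)\<close> is \<open>8 * x\<close> times a factor between 1 and a power of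
  \<open>log 2 (4 * x)\<close>, it tends to 0.\<close>

lemma zeta_exponent:
  "\<exists>\<epsilon> :: nat \<Rightarrow> real. \<epsilon> \<longlonglongrightarrow> 0 \<and>
     (\<forall>\<^sub>F n in sequentially. zeta (4 * log 2 (log 2 (real n))) = log 2 (log 2 (real n)) powr (1 + \<epsilon> n))"
proof -
  define \<delta> where "\<delta> x = ln (zeta (4 * x)) / ln x - 1" for x :: real
  have bounds: "ln (8 * x) / ln x - 1 \<le> \<delta> x \<and> \<delta> x \<le> (ln (8 * x) + ln (2 * (log 2 (4 * x)) ^ 4)) / ln x - 1"
    if "2 \<le> x" for x
  proof -
    have "2 powr 2 \<le> 4 * x" using that by simp
    then have l: "2 \<le> log 2 (4 * x)" using that by (subst le_log_iff) auto
    have z: "1 \<le> zeta (log 2 (4 * x))" "zeta (log 2 (4 * x)) \<le> 2 * (log 2 (4 * x)) ^ 4"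
      using zeta_ge_2[of "log 2 (4 * x)"] l zeta_le_power by auto
    have "ln (zeta (4 * x)) = ln (8 * x) + ln (zeta (log 2 (4 * x)))"
      using that z by (simp add: zeta_rec ln_mult)
    moreover have "0 \<le> ln (zeta (log 2 (4 * x)))" using z by simp
    moreover have "ln (zeta (log 2 (4 * x))) \<le> ln (2 * (log 2 (4 * x)) ^ 4)" using z l by (subst ln_le_cancel_iff) auto
    ultimately show ?thesis using that by (auto simp: \<delta>_def intro!: divide_right_mono)
  qed
  have "(\<delta> \<longlongrightarrow> 0) at_top"
  proof (rule tendsto_sandwich)
    show "\<forall>\<^sub>F x in at_top. ln (8 * x) / ln x - 1 \<le> \<delta> x"
      "\<forall>\<^sub>F x in at_top. \<delta> x \<le> (ln (8 * x) + ln (2 * (log 2 (4 * x)) ^ 4)) / ln x - 1"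
      by (rule eventually_mono[OF eventually_ge_at_top[of 2]], use bounds in blast)+
    show "((\<lambda>x::real. ln (8 * x) / ln x - 1) \<longlongrightarrow> 0) at_top"
      "((\<lambda>x::real. (ln (8 * x) + ln (2 * (log 2 (4 * x)) ^ 4)) / ln x - 1) \<longlongrightarrow> 0) at_top"
      by real_asymp+
  qed
  then have "(\<lambda>n. \<delta> (log 2 (log 2 (real n)))) \<longlonglongrightarrow> 0"
    using filterlim_loglog by (rule filterlim_compose)
  moreover have "zeta (4 * x) = x powr (1 + \<delta> x)" if "2 \<le> x" for x
    using that zeta_ge_2[of "4 * x"] by (simp add: powr_def \<delta>_def)
  then have "\<forall>\<^sub>F n in sequentially. zeta (4 * log 2 (log 2 (real n)))
      = log 2 (log 2 (real n)) powr (1 + \<delta> (log 2 (log 2 (real n))))"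
    using eventually_compose_filterlim[OF eventually_ge_at_top[of 2] filterlim_loglog] by (auto elim: eventually_mono)
  ultimately show ?thesis by blast
qed

theorem theorem1p1:
  shows "\<exists>D. gc_protocol D \<and>
           (\<forall>\<^sub>F n in sequentially. whp_latency D n \<noteq> \<infinity>) \<and>
           (\<lambda>n. real (the_enat (whp_latency D n)))
             \<in> O[sequentially](\<lambda>n. real n * zeta (4 * log 2 (log 2 (real n)))) \<and>
           (\<exists>\<epsilon> :: nat \<Rightarrow> real. \<epsilon> \<longlonglongrightarrow> 0 \<and>
              (\<forall>\<^sub>F n in sequentially.
                 real n * zeta (4 * log 2 (log 2 (real n)))
                   = real n * log 2 (log 2 (real n)) powr (1 + \<epsilon> n)))"
proof (rule exI[of _ cr.bit_law], intro conjI)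
  show "gc_protocol cr.bit_law" by (rule cr.gc_protocol_bit_law)
  \<comment> \<open>\<open>B\<close> depends on the series alone, not on \<open>n\<close>. The final
    constant \<open>2 * (real B + 1)\<close> combines the factor 2 of
    \<open>two_power_code_len\<close> with \<open>B * n + 1 \<le> (B + 1) * n\<close>.\<close>
  obtain B :: nat where B: "260 + 4 * suminf decay \<le> real B" using real_arch_simple by blast
  define T where "T n = 2 ^ code_len (top_level n) * (B * n + 1)" for n
  have latency: "\<forall>\<^sub>F n in sequentially. whp_latency cr.bit_law n \<le> enat (T n)"
    using failure_prob_small[of B] unfolding T_def
    by eventually_elim (rule whp_latency_le[OF B refl])
  then show "\<forall>\<^sub>F n in sequentially. whp_latency cr.bit_law n \<noteq> \<infinity>"
    by eventually_elim (auto dest: enat_ile)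
  have "\<forall>\<^sub>F n in sequentially. 1 \<le> log 2 (log 2 (real n))"
    using eventually_compose_filterlim[OF eventually_ge_at_top[of 1] filterlim_loglog] .
  with latency have "\<forall>\<^sub>F n in sequentially. norm (real (the_enat (whp_latency cr.bit_law n)))
      \<le> 2 * (real B + 1) * norm (real n * zeta (4 * log 2 (log 2 (real n))))"
    using eventually_ge_at_top[of 1]
  proof eventually_elim
    case (elim n)
    let ?z = "zeta (4 * log 2 (log 2 (real n)))"
    have I: "1 \<le> top_level n" "real (top_level n) \<le> 4 * log 2 (log 2 (real n))"
      using elim(2) by (auto simp: top_level_def le_nat_iff le_floor_iff)
    have "2 ^ code_len (top_level n) \<le> 2 * zeta (real (top_level n))"
      using I by (intro two_power_code_len) auto
    also have "\<dots> \<le> 2 * ?z" using I by (intro mult_left_mono zeta_mono) auto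
    finally have code: "2 ^ code_len (top_level n) \<le> 2 * ?z" .
    have "0 \<le> ?z" using zeta_ge_2[of "4 * log 2 (log 2 (real n))"] elim(2) by simp
    have "real (the_enat (whp_latency cr.bit_law n)) \<le> real (T n)"
      using elim(1) by (cases "whp_latency cr.bit_law n") auto
    also have "\<dots> = 2 ^ code_len (top_level n) * (real B * n + 1)" by (simp add: T_def algebra_simps)
    also have "\<dots> \<le> (2 * ?z) * ((real B + 1) * n)"
      using code elim(3) \<open>0 \<le> ?z\<close> by (intro mult_mono) (auto simp: algebra_simps)
    finally show ?case using \<open>0 \<le> ?z\<close> by (simp add: abs_mult algebra_simps)
  qed
  then show "(\<lambda>n. real (the_enat (whp_latency cr.bit_law n)))
      \<in> O[sequentially](\<lambda>n. real n * zeta (4 * log 2 (log 2 (real n))))"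
    by (rule bigoI)
  show "\<exists>\<epsilon> :: nat \<Rightarrow> real. \<epsilon> \<longlonglongrightarrow> 0 \<and>
      (\<forall>\<^sub>F n in sequentially. real n * zeta (4 * log 2 (log 2 (real n)))
        = real n * log 2 (log 2 (real n)) powr (1 + \<epsilon> n))"
    using zeta_exponent by (auto elim!: eventually_mono)
qed

end
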